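(* Let $A$ be a $C^*$-algebra. Then the semiprime ideals of $A$ form a complete sublattice of the lattice of all ideals of $A$; that is, for every family $(I_\lambda)_{\lambda\in\Lambda}$ of semiprime ideals of $A$, both the intersection $\bigcap_{\lambda\in\Lambda} I_\lambda$ and the sum $\sum_{\lambda\in\Lambda} I_\lambda$ are semiprime ideals of $A$.
   Context: $C^*$-algebras are not assumed unital. An ideal in a $C^*$-algebra $A$ is an additive subgroup $I \subseteq A$ with $aI \cup Ia \subseteq I$ for all $a \in A$; it is not assumed norm-closed, self-adjoint, or closed under complex scalars. $J^2$ denotes the additive subgroup generated by $\{xy : x,y \in J\}$. An ideal $I$ is semiprime if for all ideals $J \subseteq A$, $J^2 \subseteq I$ implies $J \subseteq I$. The ideals of $A$, ordered by inclusion, form a complete lattice in which the infimum of a family is its intersection and the supremum is its sum $\sum_\lambda I_\lambda$, the set of finite sums of elements of $\bigcup_\lambda I_\lambda$. *)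

theory Defs
  imports "HOL-Analysis.Analysis" "HOL-Computational_Algebra.Group_Closure"
begin

text \<open>
  The superclass \<open>real_normed_algebra\<close> assumes neither a unit nor commutativity, and even
  permits the zero algebra. Complex scalars are added so that they extend the real ones.
\<close>

class cstar_algebra = real_normed_algebra + banach +
  fixes scaleC :: "complex \<Rightarrow> 'a \<Rightarrow> 'a" (infixr \<open>*\<^sub>C\<close> 75)
    and star :: "'a \<Rightarrow> 'a"
  assumes scaleC_of_real: "scaleC (complex_of_real r) x = scaleR r x"
    and scaleC_add_right: "scaleC c (x + y) = scaleC c x + scaleC c y"
    and scaleC_add_left: "scaleC (c + d) x = scaleC c x + scaleC d x"
    and scaleC_scaleC: "scaleC c (scaleC d x) = scaleC (c * d) x"
    and scaleC_mult_left: "scaleC c x * y = scaleC c (x * y)"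
    and scaleC_mult_right: "x * scaleC c y = scaleC c (x * y)"
    and norm_scaleC: "norm (scaleC c x) = cmod c * norm x"
    and star_star: "star (star x) = x"
    and star_add: "star (x + y) = star x + star y"
    and star_scaleC: "star (scaleC c x) = scaleC (cnj c) (star x)"
    and star_mult: "star (x * y) = star y * star x"
    and cstar_identity: "norm (star x * x) = (norm x)\<^sup>2"

instantiation complex :: cstar_algebra
begin

definition scaleC_complex :: "complex \<Rightarrow> complex \<Rightarrow> complex"
  where "scaleC_complex c x = c * x"

definition star_complex :: "complex \<Rightarrow> complex"
  where "star_complex = cnj"

instance
  by standard
    (simp_all add: scaleC_complex_def star_complex_def scaleR_conv_of_real algebra_simps
      norm_mult power2_eq_square)

end

definition is_ideal :: "'a::ring set \<Rightarrow> bool"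
  where "is_ideal I \<longleftrightarrow>
    0 \<in> I \<and> (\<forall>x\<in>I. \<forall>y\<in>I. x + y \<in> I) \<and> (\<forall>x\<in>I. - x \<in> I) \<and>
    (\<forall>a. \<forall>x\<in>I. a * x \<in> I \<and> x * a \<in> I)"

definition ideal_square :: "'a::ring set \<Rightarrow> 'a set"
  where "ideal_square J = group_closure {x * y | x y. x \<in> J \<and> y \<in> J}"

definition semiprime_ideal :: "'a::ring set \<Rightarrow> bool"
  where "semiprime_ideal I \<longleftrightarrow>
    is_ideal I \<and> (\<forall>J. is_ideal J \<longrightarrow> ideal_square J \<subseteq> I \<longrightarrow> J \<subseteq> I)"

text \<open>Finite sums of elements of the union; the empty family has sum \<open>{0}\<close>.\<close>

definition ideal_sum :: "'i set \<Rightarrow> ('i \<Rightarrow> 'a::ring set) \<Rightarrow> 'a set"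
  where "ideal_sum \<Lambda> I = {sum_list xs | xs. set xs \<subseteq> (\<Union>l\<in>\<Lambda>. I l)}"

text \<open>
  Intersection and sum are the infimum and supremum in the inclusion order on ideals. For the
  empty family the infimum is the whole algebra, in agreement with \<open>\<Inter>{} = UNIV\<close>.
\<close>

lemma is_ideal_INT:
  assumes "\<And>l. l \<in> \<Lambda> \<Longrightarrow> is_ideal (I l)"
  shows "is_ideal (\<Inter>l\<in>\<Lambda>. I l)"
  using assms unfolding is_ideal_def by auto

lemma is_ideal_ideal_sum:
  assumes "\<And>l. l \<in> \<Lambda> \<Longrightarrow> is_ideal (I l)"
  shows "is_ideal (ideal_sum \<Lambda> I)"
proof -
  let ?U = "\<Union>l\<in>\<Lambda>. I l"
  have U: "- x \<in> ?U" "a * x \<in> ?U" "x * a \<in> ?U" if "x \<in> ?U" for a x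
    using that assms unfolding is_ideal_def by blast+
  have sumI: "sum_list xs \<in> ideal_sum \<Lambda> I" if "set xs \<subseteq> ?U" for xs
    using that unfolding ideal_sum_def by blast
  have "0 \<in> ideal_sum \<Lambda> I"
    using sumI[of "[]"] by simp
  moreover have "x + y \<in> ideal_sum \<Lambda> I"
    if x: "x \<in> ideal_sum \<Lambda> I" and y: "y \<in> ideal_sum \<Lambda> I" for x y
  proof -
    obtain xs ys where "set xs \<subseteq> ?U" "x = sum_list xs" "set ys \<subseteq> ?U" "y = sum_list ys"
      using x y unfolding ideal_sum_def by blast
    then show ?thesis using sumI[of "xs @ ys"] by simp
  qed
  moreover have "- x \<in> ideal_sum \<Lambda> I \<and> a * x \<in> ideal_sum \<Lambda> I \<and> x * a \<in> ideal_sum \<Lambda> I"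
    if x: "x \<in> ideal_sum \<Lambda> I" for a x
  proof -
    obtain xs where xs: "set xs \<subseteq> ?U" "x = sum_list xs"
      using x unfolding ideal_sum_def by blast
    have "- x = sum_list (map uminus xs)"
      unfolding xs(2) by (rule uminus_sum_list_map[of id, simplified])
    moreover have "a * x = sum_list (map ((*) a) xs)" "x * a = sum_list (map (\<lambda>y. y * a) xs)"
      unfolding xs(2) by (induction xs) (simp_all add: distrib_left distrib_right)
    moreover have "set (map uminus xs) \<subseteq> ?U" "set (map ((*) a) xs) \<subseteq> ?U"
      "set (map (\<lambda>y. y * a) xs) \<subseteq> ?U"
      unfolding set_map by (intro image_subsetI U; erule subsetD[OF xs(1)])+
    ultimately show ?thesis using sumI by metis
  qed
  ultimately show ?thesis unfolding is_ideal_def by blast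
qed

lemma ideal_sum_upper:
  assumes "l \<in> \<Lambda>"
  shows "I l \<subseteq> ideal_sum \<Lambda> I"
proof
  fix x assume "x \<in> I l"
  then have "set [x] \<subseteq> (\<Union>l\<in>\<Lambda>. I l)" "x = sum_list [x]"
    using assms by auto
  then show "x \<in> ideal_sum \<Lambda> I"
    unfolding ideal_sum_def by blast
qed

lemma ideal_sum_least:
  assumes "is_ideal K" and "\<And>l. l \<in> \<Lambda> \<Longrightarrow> I l \<subseteq> K"
  shows "ideal_sum \<Lambda> I \<subseteq> K"
proof -
  have "set xs \<subseteq> K \<Longrightarrow> sum_list xs \<in> K" for xs
    using assms(1) unfolding is_ideal_def by (induction xs) auto
  then show ?thesis
    using assms(2) unfolding ideal_sum_def by blast
qed

end

(*
  Call an ideal root closed if it contains every positive p with p^2 in it. An ideal is semiprime if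
  and only if it is root closed, and root closedness passes to sums.

  Semiprime ideals are root closed: let l be self-adjoint with l^4 in I. If 0 <= b <= C l^6, then
  b^(1/2) = r l^2 = l^2 r^*, so b = r l^4 r^* lies in I. By polarization l^3 A l^3 is contained in I,
  hence l^3 is in I, and this gain in the exponent can be iterated.

  Sums: if h = sum_i w_i^* w_i with w_i in I_i, put c_i = w_i h^(-1/4). Then
  h^(1/2) = sum_i c_i^* c_i and (c_i c_i^* )^2 = w_i h^(-1/2) w_i^* w_i h^(-1/2) w_i^* <= w_i w_i^*, so
  that c_i is in I_i. Iterating, all roots h^(1/2^k) lie in the sum K of the I_i. If p >= 0 and p^2 is in
  K, then p^2 <= h for such an h, and p factors through a root of h.

  The functional calculus is replaced by power series and recursions in the unitization.
*)
theory Submission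
  imports Defs
begin

subsection \<open>Unitization\<close>

text \<open>The ideals need not be norm-closed, so no limit may be taken inside them. Convergent
  series only produce cofactors in the algebra, and each membership comes from an exact
  factorization through an element already known to lie in the ideal. Complex scalars, under which
  ideals need not be closed either, are absorbed into the cofactors. Such factorizations lose
  exponent: z^* z <= k yields z = r k^a for a < 1/2, but in general not for a = 1/2. The version
  used here has a = 1/3, with k a multiple of l^6. In a root closed ideal the loss is harmless,
  since the ideal contains arbitrarily small dyadic powers of each of its positive elements. For a
  semiprime ideal these roots are not yet available, and the loss is the reason why one step only
  leads from l^4 to l^3.\<close>

lemma scaleC_zero_right [simp]: "scaleC c (0::'a::cstar_algebra) = 0"
  using scaleC_add_right[of c 0 0] by simp

lemma scaleC_zero_left [simp]: "scaleC 0 (x::'a::cstar_algebra) = 0"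
  using scaleC_add_left[of 0 0 x] by simp

lemma scaleC_one [simp]: "scaleC 1 (x::'a::cstar_algebra) = x"
  using scaleC_of_real[of 1 x] by simp

lemma scaleC_minus_left: "scaleC (- c) (x::'a::cstar_algebra) = - scaleC c x"
  using scaleC_add_left[of c "- c" x] by (simp add: eq_neg_iff_add_eq_0 add.commute)

lemma scaleC_minus_right: "scaleC c (- x::'a::cstar_algebra) = - scaleC c x"
  using scaleC_add_right[of c x "- x"] by (simp add: eq_neg_iff_add_eq_0 add.commute)

lemma scaleC_diff_right: "scaleC c (x - y :: 'a::cstar_algebra) = scaleC c x - scaleC c y"
  using scaleC_add_right[of c x "- y"] by (simp add: scaleC_minus_right)

lemma scaleC_scaleR: "scaleC c (scaleR r (x::'a::cstar_algebra)) = scaleR r (scaleC c x)"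
  by (simp add: scaleC_of_real[symmetric] scaleC_scaleC mult.commute)

lemma star_zero [simp]: "star (0::'a::cstar_algebra) = 0"
  using star_add[of 0 "0::'a"] by simp

lemma star_minus: "star (- x::'a::cstar_algebra) = - star x"
  using star_add[of x "- x"] by (simp add: eq_neg_iff_add_eq_0 add.commute)

lemma star_diff: "star (x - y::'a::cstar_algebra) = star x - star y"
  using star_add[of x "- y"] by (simp add: star_minus)

lemma star_scaleR: "star (scaleR r (x::'a::cstar_algebra)) = scaleR r (star x)"
  by (simp add: scaleC_of_real[symmetric] star_scaleC)

lemma norm_star [simp]: "norm (star (x::'a::cstar_algebra)) = norm x"
proof -
  have "norm y \<le> norm (star y)" for y :: 'a
  proof (cases "y = 0")
    case False
    have "norm y * norm y \<le> norm (star y) * norm y"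
      using norm_mult_ineq[of "star y" y] by (simp add: cstar_identity power2_eq_square)
    then show ?thesis using False by simp
  qed simp
  from this[of x] this[of "star x"] show ?thesis by (simp add: star_star)
qed

lemma star_mult_self_eq_0 [simp]: "star x * x = 0 \<longleftrightarrow> x = (0::'a::cstar_algebra)"
  using cstar_identity[of x] by auto

lemma bounded_linear_star: "bounded_linear (star :: 'a::cstar_algebra \<Rightarrow> 'a)"
  by (rule bounded_linear_intro[where K = 1]) (simp_all add: star_add star_scaleR)

datatype 'a unitization = Unitization (vec_part: 'a) (scal_part: complex)

lemma unitization_eq_iff:
  "u = v \<longleftrightarrow> vec_part u = vec_part v \<and> scal_part u = scal_part v"
  by (cases u, cases v) simp

text \<open>Left multiplication by \<open>u\<close> on the algebra, seen as an ideal of its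
  unitization. Its operator norm is the source of the C*-norm.\<close>

definition lrep :: "'a::cstar_algebra unitization \<Rightarrow> 'a \<Rightarrow> 'a"
  where "lrep u b = vec_part u * b + scaleC (scal_part u) b"

lemma bounded_linear_lrep: "bounded_linear (lrep u)"
proof (rule bounded_linear_intro)
  show "norm (lrep u x) \<le> norm x * (norm (vec_part u) + cmod (scal_part u))" for x
    unfolding lrep_def
    by (rule order_trans[OF norm_triangle_ineq])
      (simp add: norm_scaleC algebra_simps, metis norm_mult_ineq mult.commute)
qed (simp_all add: lrep_def scaleC_add_right scaleC_scaleR algebra_simps)

instantiation unitization :: (cstar_algebra) real_normed_algebra_1
begin

definition "0 = Unitization 0 0"
definition "1 = Unitization 0 1"
definition "u + v = Unitization (vec_part u + vec_part v) (scal_part u + scal_part v)"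
definition "- u = Unitization (- vec_part u) (- scal_part u)"
definition "u - v = Unitization (vec_part u - vec_part v) (scal_part u - scal_part v)"
definition "u * v = Unitization
  (vec_part u * vec_part v + scaleC (scal_part u) (vec_part v) + scaleC (scal_part v) (vec_part u))
  (scal_part u * scal_part v)"
definition "scaleR r u = Unitization (scaleR r (vec_part u)) (scaleR r (scal_part u))"
text \<open>The operator norm alone fails to be definite when \<open>'a\<close> is already unital; the maximum with
  the modulus of the scalar part is a C*-norm in every case.\<close>
definition norm_unitization_def: "norm (u :: 'a unitization) = max (onorm (lrep u)) (cmod (scal_part u))"
definition sgn_unitization_def: "sgn (u :: 'a unitization) = inverse (norm u) *\<^sub>R u"
definition dist_unitization_def: "dist (u :: 'a unitization) v = norm (u - v)"
definition uniformity_unitization_def: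
  "(uniformity :: ('a unitization \<times> 'a unitization) filter) =
    (INF e\<in>{0<..}. principal {(u, v). dist u v < e})"
definition open_unitization_def:
  "open (S :: 'a unitization set) \<longleftrightarrow>
    (\<forall>u\<in>S. eventually (\<lambda>(u', v). u' = u \<longrightarrow> v \<in> S) uniformity)"

lemmas unitization_defs = zero_unitization_def one_unitization_def plus_unitization_def
  uminus_unitization_def minus_unitization_def times_unitization_def scaleR_unitization_def

lemma lrep_simps:
  "lrep (u + v) = (\<lambda>b. lrep u b + lrep v b)" "lrep (u * v) = lrep u \<circ> lrep v"
  "lrep (scaleR r u) = (\<lambda>b. scaleR r (lrep u b))"
  by (rule ext, simp add: lrep_def unitization_defs algebra_simps scaleC_add_left scaleC_add_right
      scaleC_mult_left scaleC_mult_right scaleC_scaleC scaleC_of_real[symmetric] scaleC_complex_def)+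

lemma norm_lrep_le: "norm (lrep u b) \<le> norm u * norm b"
  using onorm[OF bounded_linear_lrep, of u b]
  by (rule order_trans) (simp add: norm_unitization_def mult_right_mono)

lemma norm_unitization_leI:
  assumes "\<And>b. norm (lrep u b) \<le> B * norm b" "cmod (scal_part u) \<le> B"
  shows "norm u \<le> B"
  using onorm_bound[of B "lrep u"] assms norm_ge_zero[of "scal_part u"]
  by (simp add: norm_unitization_def)

lemma scal_part_le_norm: "cmod (scal_part u) \<le> norm u"
  by (simp add: norm_unitization_def)

lemma norm_unitization_nonneg: "0 \<le> norm (u :: 'a unitization)"
  using scal_part_le_norm[of u] norm_ge_zero[of "scal_part u"] by linarith

lemma norm_unitization_mult: "norm (u * v) \<le> norm u * norm (v :: 'a unitization)"
proof (rule norm_unitization_leI)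
  show "norm (lrep (u * v) b) \<le> norm u * norm v * norm b" for b
    using norm_lrep_le[of u "lrep v b"] norm_lrep_le[of v b] norm_unitization_nonneg[of u]
    by (simp add: lrep_simps mult.assoc) (meson mult_left_mono order_trans)
  show "cmod (scal_part (u * v)) \<le> norm u * norm v"
    by (simp add: unitization_defs norm_mult mult_mono scal_part_le_norm norm_unitization_nonneg)
qed

lemma norm_unitization_scaleR: "norm (scaleR r u) = \<bar>r\<bar> * norm (u :: 'a unitization)"
  by (simp add: norm_unitization_def lrep_simps onorm_scaleR[OF bounded_linear_lrep]
      max_mult_distrib_left) (simp add: unitization_defs)

lemma norm_unitization_eq_0: "norm u = 0 \<longleftrightarrow> u = (0 :: 'a unitization)"
proof
  assume u: "norm u = 0"
  then have s: "scal_part u = 0" using scal_part_le_norm[of u] by simp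
  have "norm (lrep u (star (vec_part u))) = 0"
    using norm_lrep_le[of u "star (vec_part u)"] u by simp
  then have "star (star (vec_part u)) * star (vec_part u) = 0"
    by (simp add: lrep_def s star_star)
  then have "vec_part u = 0" by (metis star_mult_self_eq_0 star_star star_zero)
  with s show "u = 0" by (simp add: unitization_eq_iff unitization_defs)
next
  assume "u = 0"
  then show "norm u = 0"
    by (metis norm_unitization_scaleR abs_zero mult_zero_left scaleR_zero_left scaleR_zero_right
        unitization_defs(1,7) unitization.sel)
qed

lemma norm_unitization_triangle: "norm (u + v) \<le> norm u + norm (v :: 'a unitization)"
proof (rule norm_unitization_leI)
  show "norm (lrep (u + v) b) \<le> (norm u + norm v) * norm b" for b
    using norm_triangle_ineq[of "lrep u b" "lrep v b"] norm_lrep_le[of u b] norm_lrep_le[of v b]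
    by (simp add: lrep_simps distrib_right)
  show "cmod (scal_part (u + v)) \<le> norm u + norm v"
    using norm_triangle_ineq[of "scal_part u" "scal_part v"] scal_part_le_norm[of u]
      scal_part_le_norm[of v]
    by (simp add: unitization_defs)
qed

text \<open>Needed for completeness: coordinates of a Cauchy sequence are Cauchy. Testing the
  operator on \<open>star ?a\<close> recovers the norm through the C*-identity.\<close>

lemma norm_vec_part_le: "norm (vec_part u) \<le> 2 * norm (u :: 'a unitization)"
proof (cases "vec_part u = 0")
  case True
  then show ?thesis using norm_unitization_nonneg[of u] by simp
next
  case False
  let ?a = "vec_part u"
  have "(norm ?a)\<^sup>2 = norm (?a * star ?a)"
    using cstar_identity[of "star ?a"] by (simp add: star_star)
  also have "\<dots> = norm (lrep u (star ?a) - scaleC (scal_part u) (star ?a))"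
    by (simp add: lrep_def)
  also have "\<dots> \<le> norm u * norm ?a + cmod (scal_part u) * norm ?a"
    using norm_triangle_ineq4[of "lrep u (star ?a)" "scaleC (scal_part u) (star ?a)"]
      norm_lrep_le[of u "star ?a"]
    by (simp add: norm_scaleC)
  also have "\<dots> \<le> (2 * norm u) * norm ?a"
    using mult_right_mono[OF scal_part_le_norm[of u], of "norm ?a"] by simp
  finally show ?thesis using False by (simp add: power2_eq_square)
qed

lemma norm_unitization_le: "norm u \<le> norm (vec_part u) + cmod (scal_part u)"
proof (rule norm_unitization_leI)
  show "norm (lrep u b) \<le> (norm (vec_part u) + cmod (scal_part u)) * norm b" for b
    unfolding lrep_def
    by (rule order_trans[OF norm_triangle_ineq])
      (simp add: norm_scaleC algebra_simps, metis norm_mult_ineq mult.commute)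
qed simp

instance
proof
  fix u v w :: "'a unitization" and a b :: real
  show "u + v + w = u + (v + w)" "u + v = v + u" "0 + u = u" "- u + u = 0" "u - v = u + - v"
    by (simp_all add: unitization_eq_iff unitization_defs)
  show "a *\<^sub>R (u + v) = a *\<^sub>R u + a *\<^sub>R v" "(a + b) *\<^sub>R u = a *\<^sub>R u + b *\<^sub>R u"
    "a *\<^sub>R b *\<^sub>R u = (a * b) *\<^sub>R u" "1 *\<^sub>R u = u"
    by (simp_all add: unitization_eq_iff unitization_defs algebra_simps)
  show "u * v * w = u * (v * w)" "(u + v) * w = u * w + v * w" "u * (v + w) = u * v + u * w"
    "1 * u = u" "u * 1 = u" "0 \<noteq> (1 :: 'a unitization)"
    by (simp_all add: unitization_eq_iff unitization_defs algebra_simps scaleC_add_left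
        scaleC_add_right scaleC_mult_left scaleC_mult_right scaleC_scaleC)
  show "a *\<^sub>R u * v = a *\<^sub>R (u * v)" "u * a *\<^sub>R v = a *\<^sub>R (u * v)"
    by (simp_all add: unitization_eq_iff unitization_defs algebra_simps scaleC_add_left
        scaleC_add_right scaleC_scaleC scaleC_of_real[symmetric] scaleC_mult_left
        scaleC_mult_right scaleC_complex_def)
  show "dist u v = norm (u - v)" by (rule dist_unitization_def)
  show "sgn u = inverse (norm u) *\<^sub>R u" by (rule sgn_unitization_def)
  show "uniformity = (INF e\<in>{0<..}. principal {(u :: 'a unitization, v). dist u v < e})"
    by (rule uniformity_unitization_def)
  show "open S \<longleftrightarrow> (\<forall>u\<in>S. eventually (\<lambda>(u', v). u' = u \<longrightarrow> v \<in> S) uniformity)"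
    for S :: "'a unitization set" by (rule open_unitization_def)
  show "norm u = 0 \<longleftrightarrow> u = 0" by (rule norm_unitization_eq_0)
  show "norm (u + v) \<le> norm u + norm v" by (rule norm_unitization_triangle)
  show "norm (a *\<^sub>R u) = \<bar>a\<bar> * norm u" by (rule norm_unitization_scaleR)
  show "norm (u * v) \<le> norm u * norm v" by (rule norm_unitization_mult)
  show "norm (1 :: 'a unitization) = 1"
    using norm_unitization_le[of 1] scal_part_le_norm[of 1] by (simp add: unitization_defs)
qed

end

lemma vec_part_diff: "vec_part (u - v) = vec_part u - vec_part v"
  and scal_part_diff: "scal_part (u - v) = scal_part u - scal_part v"
  by (simp_all add: minus_unitization_def)

instance unitization :: (cstar_algebra) banach
proof
  fix X :: "nat \<Rightarrow> 'a unitization"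
  assume X: "Cauchy X"
  then have X': "\<exists>M. \<forall>m\<ge>M. \<forall>n\<ge>M. norm (X m - X n) < e" if "e > 0" for e
    using CauchyD that by blast
  have "Cauchy (\<lambda>n. vec_part (X n))"
  proof (rule CauchyI)
    fix e :: real assume "0 < e"
    then obtain M where "\<forall>m\<ge>M. \<forall>n\<ge>M. norm (X m - X n) < e / 2" using X'[of "e / 2"] by auto
    then show "\<exists>M. \<forall>m\<ge>M. \<forall>n\<ge>M. norm (vec_part (X m) - vec_part (X n)) < e"
      using le_less_trans[OF norm_vec_part_le[of "X m - X n" for m n]]
      by (intro exI[of _ M] allI impI) (simp add: vec_part_diff[symmetric] mult.commute)
  qed
  then obtain a where a: "(\<lambda>n. vec_part (X n)) \<longlonglongrightarrow> a"
    using Cauchy_convergent_iff convergent_def by blast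
  have "Cauchy (\<lambda>n. scal_part (X n))"
  proof (rule CauchyI)
    fix e :: real assume "0 < e"
    then obtain M where "\<forall>m\<ge>M. \<forall>n\<ge>M. norm (X m - X n) < e" using X'[of e] by auto
    then show "\<exists>M. \<forall>m\<ge>M. \<forall>n\<ge>M. norm (scal_part (X m) - scal_part (X n)) < e"
      using le_less_trans[OF scal_part_le_norm[of "X m - X n" for m n]]
      by (intro exI[of _ M] allI impI) (simp add: scal_part_diff[symmetric])
  qed
  then obtain s where s: "(\<lambda>n. scal_part (X n)) \<longlonglongrightarrow> s"
    using Cauchy_convergent_iff convergent_def by blast
  have "(\<lambda>n. norm (vec_part (X n) - a) + cmod (scal_part (X n) - s)) \<longlonglongrightarrow> 0"
    using tendsto_add[OF tendsto_norm_zero[OF LIM_zero[OF a]]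
        tendsto_norm_zero[OF LIM_zero[OF s]]] by simp
  then have "(\<lambda>n. X n - Unitization a s) \<longlonglongrightarrow> 0"
    by (rule Lim_null_comparison[rotated])
      (rule always_eventually, metis norm_unitization_le vec_part_diff scal_part_diff
        unitization.sel)
  then show "convergent X"
    using LIM_zero_iff convergent_def by blast
qed

instantiation unitization :: (cstar_algebra) cstar_algebra
begin

definition "scaleC c u = Unitization (scaleC c (vec_part u)) (c * scal_part u)"
definition "star u = Unitization (star (vec_part u)) (cnj (scal_part u))"

lemmas unitization_cstar_defs = scaleC_unitization_def star_unitization_def

lemma lrep_scaleC: "lrep (scaleC c u) b = scaleC c (lrep u b)"
  by (simp add: lrep_def unitization_cstar_defs scaleC_add_right scaleC_mult_left scaleC_scaleC)

text \<open>For the inner product x^* y on the algebra this says that \<open>star u\<close> acts as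
  the adjoint of \<open>u\<close>; it carries the C*-identity over to the operator norm.\<close>

lemma star_lrep: "star b * lrep (star u * u) b = star (lrep u b) * lrep u b"
  by (simp add: lrep_def unitization_defs unitization_cstar_defs algebra_simps scaleC_add_left scaleC_add_right star_mult
      scaleC_mult_left scaleC_mult_right scaleC_scaleC star_add star_scaleC)

lemma norm_unitization_cstar: "norm (star u * u) = (norm (u :: 'a unitization))\<^sup>2"
proof -
  have le: "(norm u)\<^sup>2 \<le> norm (star u * u)" for u :: "'a unitization"
  proof -
    have "norm u \<le> sqrt (norm (star u * u))"
    proof (rule norm_unitization_leI)
      fix b
      have "(norm (lrep u b))\<^sup>2 = norm (star b * lrep (star u * u) b)"
        by (simp add: star_lrep cstar_identity)
      also have "\<dots> \<le> norm b * (norm (star u * u) * norm b)"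
        using norm_mult_ineq[of "star b" "lrep (star u * u) b"] norm_lrep_le[of "star u * u" b]
        by (simp) (meson mult_left_mono norm_ge_zero order_trans)
      also have "\<dots> = (sqrt (norm (star u * u)) * norm b)\<^sup>2"
        by (simp add: power2_eq_square norm_ge_zero algebra_simps)
      finally show "norm (lrep u b) \<le> sqrt (norm (star u * u)) * norm b"
        by (rule power2_le_imp_le) (simp add: norm_ge_zero)
      have "cmod (scal_part u) ^ 2 \<le> norm (star u * u)"
        using scal_part_le_norm[of "star u * u"]
        by (simp add: unitization_defs unitization_cstar_defs norm_mult power2_eq_square)
      then show "cmod (scal_part u) \<le> sqrt (norm (star u * u))" by (simp add: real_le_rsqrt)
    qed
    then show ?thesis
      by (metis norm_ge_zero power_mono real_sqrt_pow2)
  qed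
  \<comment> \<open>The involution is not yet known to be isometric, and the upper bound for the
    norm of \<open>star u * u\<close> rests on that.\<close>
  have star_le: "norm u \<le> norm (star u)" for u :: "'a unitization"
  proof (cases "norm u = 0")
    case False
    have "norm u * norm u \<le> norm (star u) * norm u"
      using le[of u] norm_mult_ineq[of "star u" u] by (simp add: power2_eq_square)
    then show ?thesis using False norm_ge_zero[of u] by simp
  qed (simp add: norm_ge_zero)
  have "star (star u) = u"
    by (simp add: unitization_eq_iff unitization_defs unitization_cstar_defs star_star)
  then have "norm (star u) \<le> norm u" using star_le[of "star u"] by simp
  then have "norm (star u * u) \<le> (norm u)\<^sup>2"
    using norm_mult_ineq[of "star u" u]
    by (simp add: power2_eq_square) (meson mult_right_mono norm_ge_zero order_trans)
  with le show ?thesis by (simp add: order_antisym)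
qed

instance
proof
  fix u v w :: "'a unitization" and a b :: real and c d :: complex
  show "complex_of_real a *\<^sub>C u = a *\<^sub>R u"
    by (simp add: unitization_eq_iff unitization_defs unitization_cstar_defs scaleC_of_real scaleR_conv_of_real)
  show "c *\<^sub>C (u + v) = c *\<^sub>C u + c *\<^sub>C v" "(c + d) *\<^sub>C u = c *\<^sub>C u + d *\<^sub>C u"
    "c *\<^sub>C d *\<^sub>C u = (c * d) *\<^sub>C u" "c *\<^sub>C u * v = c *\<^sub>C (u * v)"
    "u * c *\<^sub>C v = c *\<^sub>C (u * v)" "star (star u) = u" "star (u + v) = star u + star v"
    "star (c *\<^sub>C u) = cnj c *\<^sub>C star u" "star (u * v) = star v * star u"
    by (simp_all add: unitization_eq_iff unitization_defs unitization_cstar_defs algebra_simps scaleC_add_left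
        scaleC_add_right scaleC_mult_left scaleC_mult_right scaleC_scaleC star_star star_add
        star_mult star_scaleC)
  show "norm (star u * u) = (norm u)\<^sup>2" by (rule norm_unitization_cstar)
  have "norm (c *\<^sub>C u) \<le> cmod c * norm u" for c and u :: "'a unitization"
  proof (rule norm_unitization_leI)
    show "norm (lrep (c *\<^sub>C u) b) \<le> cmod c * norm u * norm b" for b
      using norm_lrep_le[of u b] by (simp add: lrep_scaleC norm_scaleC mult.assoc mult_left_mono)
  qed (simp add: unitization_defs unitization_cstar_defs norm_mult mult_left_mono scal_part_le_norm)
  note le = this
  show "norm (c *\<^sub>C u) = cmod c * norm u"
  proof (cases "c = 0")
    case True
    then have "c *\<^sub>C u = 0" by (simp add: unitization_defs unitization_cstar_defs)
    with True norm_eq_zero show ?thesis by simp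
  next
    case False
    then have "inverse c *\<^sub>C c *\<^sub>C u = u"
      by (simp add: unitization_eq_iff unitization_defs unitization_cstar_defs scaleC_scaleC)
    then have "norm u \<le> norm (c *\<^sub>C u) / cmod c"
      using le[of "inverse c" "c *\<^sub>C u"] by (simp add: norm_inverse divide_inverse mult.commute)
    then show ?thesis using le[of c u] False by (simp add: field_simps)
  qed
qed

end

subsection \<open>Positivity in unital C*-algebras\<close>

text \<open>Self-adjoint with nonnegative spectrum, phrased through the norm; unlike for elements of the
  form \<open>y\<^sup>* y\<close>, closure under sums is evident.\<close>
definition upos :: "'a::{cstar_algebra, real_normed_algebra_1} \<Rightarrow> bool"
  where "upos x \<longleftrightarrow> star x = x \<and> (\<exists>t\<ge>0. norm (t *\<^sub>R 1 - x) \<le> t)"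

lemma star_one [simp]: "star (1 :: 'a::{cstar_algebra, real_normed_algebra_1}) = 1"
  using star_mult[of 1 "star (1::'a)"] by (simp add: star_star)

lemma upos_selfadjoint: "upos x \<Longrightarrow> star x = x"
  by (simp add: upos_def)

lemma upos_zero [simp]: "upos 0"
  by (auto simp: upos_def)

lemma upos_add:
  assumes "upos x" "upos y"
  shows "upos (x + y)"
proof -
  obtain s t where st: "0 \<le> s" "0 \<le> t" "norm (s *\<^sub>R 1 - x) \<le> s" "norm (t *\<^sub>R 1 - y) \<le> t"
    using assms by (auto simp: upos_def)
  have "norm ((s + t) *\<^sub>R 1 - (x + y)) \<le> s + t"
    using norm_triangle_le[of "s *\<^sub>R 1 - x" "t *\<^sub>R 1 - y" "s + t"] st by (simp add: algebra_simps)
  moreover have "star (x + y) = x + y"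
    using assms by (simp add: upos_def star_add)
  ultimately show ?thesis
    using st unfolding upos_def by (metis add_nonneg_nonneg)
qed

lemma upos_scaleR:
  assumes "upos x" "0 \<le> r"
  shows "upos (r *\<^sub>R x)"
proof -
  obtain t where t: "0 \<le> t" "norm (t *\<^sub>R 1 - x) \<le> t"
    using assms by (auto simp: upos_def)
  have "norm ((r * t) *\<^sub>R 1 - r *\<^sub>R x) = r * norm (t *\<^sub>R 1 - x)"
    using assms(2) by (simp flip: scaleR_scaleR scaleR_diff_right)
  then have "norm ((r * t) *\<^sub>R 1 - r *\<^sub>R x) \<le> r * t"
    using t assms(2) by (simp add: mult_left_mono)
  then show ?thesis
    using assms t unfolding upos_def by (metis star_scaleR mult_nonneg_nonneg)
qed

lemma upos_norm_minus:
  assumes "star x = x" "norm x \<le> t"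
  shows "upos (t *\<^sub>R 1 - x)"
proof -
  have "0 \<le> t" using assms(2) norm_ge_zero order_trans by blast
  with assms show ?thesis by (auto simp: upos_def star_diff star_scaleR intro!: exI[of _ t])
qed

text \<open>The recursion \<open>s \<mapsto> (y + s\<^sup>2) / 2\<close> converges to \<open>1 - sqrt (1 - y)\<close>; the increments are dominated
  by those of the scalar sequence with \<open>y = 1\<close>.\<close>
lemma ex_sqrt_one_minus:
  fixes y :: "'a::{cstar_algebra, real_normed_algebra_1}"
  assumes y: "norm y \<le> 1" "star y = y"
  obtains s where "s * s = 1 - y" "star s = s" "norm (1 - s) \<le> 1" "\<And>z. z * y = y * z \<Longrightarrow> z * s = s * z"
proof -
  define f where "f = rec_nat 0 (\<lambda>_ s. (1/2) *\<^sub>R (y + s * s))"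
  define t where "t = rec_nat 0 (\<lambda>_ s :: real. (1 + s * s) / 2)"
  have f: "f 0 = 0" "f (Suc n) = (1/2) *\<^sub>R (y + f n * f n)" for n by (simp_all add: f_def)
  have t: "t 0 = 0" "t (Suc n) = (1 + t n * t n) / 2" for n by (simp_all add: t_def)
  have t01: "0 \<le> t n \<and> t n \<le> 1" for n
  proof (induction n)
    case (Suc n)
    then have "t n * t n \<le> 1" by (simp add: mult_le_one)
    then show ?case by (simp add: t)
  qed (simp add: t)
  have fy: "z * f n = f n * z" if "z * y = y * z" for z n
  proof (induction n)
    case (Suc n)
    have "z * (f n * f n) = (f n * f n) * z" using Suc by (metis mult.assoc)
    with that show ?case by (simp add: f distrib_left distrib_right)
  qed (simp add: f)
  have fn: "norm (f n) \<le> t n" for n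
  proof (induction n)
    case (Suc n)
    have "norm (f n * f n) \<le> t n * t n"
      using norm_mult_ineq[of "f n" "f n"] mult_mono[OF Suc Suc] t01[of n] by simp
    then have "norm (y + f n * f n) \<le> 1 + t n * t n"
      using norm_triangle_le[of y "f n * f n"] y by simp
    then show ?case by (simp add: f t)
  qed (simp add: f t)
  have ff: "f n * f m = f m * f n" for m n
    by (rule fy, rule fy[symmetric], rule refl)
  have df: "norm (f (Suc n) - f n) \<le> t (Suc n) - t n" for n
  proof (induction n)
    case 0
    then show ?case using y by (simp add: f t)
  next
    case (Suc n)
    have "f (Suc (Suc n)) - f (Suc n) = (1/2) *\<^sub>R (f (Suc n) * f (Suc n) - f n * f n)"
      by (simp only: f(2)[of "Suc n"] f(2)[of n] scaleR_diff_right[symmetric]) simp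
    also have "f (Suc n) * f (Suc n) - f n * f n = (f (Suc n) - f n) * (f (Suc n) + f n)"
      using ff[of n "Suc n"] by (simp add: algebra_simps)
    finally have "norm (f (Suc (Suc n)) - f (Suc n)) \<le> (1/2) * (norm (f (Suc n) - f n) * norm (f (Suc n) + f n))"
      by (simp add: norm_mult_ineq)
    also have "\<dots> \<le> (1/2) * ((t (Suc n) - t n) * (t (Suc n) + t n))"
      using Suc norm_triangle_le[of "f (Suc n)" "f n" "t (Suc n) + t n"] fn[of n] fn[of "Suc n"]
        order_trans[OF norm_ge_zero Suc]
      by (intro mult_left_mono mult_mono) auto
    also have "\<dots> = t (Suc (Suc n)) - t (Suc n)"
      by (simp add: t(2)[of "Suc n"] t(2)[of n] field_simps)
    finally show ?case .
  qed
  have inc: "t n \<le> t (Suc n)" for n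
    using df[of n] norm_ge_zero[of "f (Suc n) - f n"] by linarith
  have "incseq t" using inc by (rule incseq_SucI)
  then obtain L where "t \<longlonglongrightarrow> L"
    using incseq_convergent[of t 1] t01 by blast
  then have "summable (\<lambda>n. t (Suc n) - t n)"
    using telescope_summable by blast
  then have "summable (\<lambda>n. f (Suc n) - f n)"
    by (rule summable_comparison_test'[where N = 0]) (rule df)
  then have "convergent (\<lambda>n. \<Sum>k<n. f (Suc k) - f k)"
    by (simp add: summable_iff_convergent)
  then obtain l where l: "f \<longlonglongrightarrow> l"
    by (auto simp: sum_lessThan_telescope f(1) convergent_def)
  have "(\<lambda>n. f (Suc n)) \<longlonglongrightarrow> (1/2) *\<^sub>R (y + l * l)"
    unfolding f by (intro tendsto_intros l)
  then have eq: "l = (1/2) *\<^sub>R (y + l * l)"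
    using LIMSEQ_unique l LIMSEQ_Suc by blast
  then have "l + l = y + l * l"
    by (metis scaleR_half_double scaleR_right_distrib)
  then have "(1 - l) * (1 - l) = 1 - y" by (simp add: algebra_simps)
  moreover have "star (f n) = f n" for n
    using y by (induction n) (simp_all add: f star_scaleR star_add star_mult)
  then have "star l = l"
    using LIMSEQ_unique[OF bounded_linear.tendsto[OF bounded_linear_star l]] l by simp
  moreover have "norm l \<le> 1"
    by (rule Lim_bounded[OF tendsto_norm[OF l], of 0]) (use fn t01 order_trans in blast)
  moreover have "z * (1 - l) = (1 - l) * z" if "z * y = y * z" for z
  proof -
    have "(\<lambda>n. z * f n) \<longlonglongrightarrow> l * z"
      unfolding fy[OF that] by (intro tendsto_intros l)
    moreover have "(\<lambda>n. z * f n) \<longlonglongrightarrow> z * l"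
      by (intro tendsto_intros l)
    ultimately have "z * l = l * z" using LIMSEQ_unique by blast
    then show ?thesis by (simp add: left_diff_distrib right_diff_distrib)
  qed
  moreover have "star (1 - l) = 1 - l" "norm (1 - (1 - l)) \<le> 1"
    using \<open>star l = l\<close> \<open>norm l \<le> 1\<close> by (simp_all add: star_diff)
  ultimately show ?thesis using that by blast
qed

text \<open>The commutation clause stands in for the functional calculus: roots of commuting
  elements can be chosen to commute.\<close>

lemma ex_sqrt:
  assumes "upos x"
  obtains s where "upos s" "s * s = x" "\<And>z. z * x = x * z \<Longrightarrow> z * s = s * z"
proof -
  obtain t0 where t0: "0 \<le> t0" "norm (t0 *\<^sub>R 1 - x) \<le> t0"
    using assms by (auto simp: upos_def)
  \<comment> \<open>\<open>t0\<close> may be 0; the shift permits division and preserves the bound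
    because 1 has norm 1.\<close>
  define t where "t = t0 + 1"
  have t: "0 < t" using t0 by (simp add: t_def)
  have "t *\<^sub>R 1 - x = (t0 *\<^sub>R 1 - x) + 1" by (simp add: t_def algebra_simps)
  moreover have "norm ((t0 *\<^sub>R 1 - x) + 1) \<le> t"
    using t0 by (intro norm_triangle_le) (simp add: t_def)
  ultimately have tx: "norm (t *\<^sub>R 1 - x) \<le> t" by metis
  define y where "y = (1/t) *\<^sub>R (t *\<^sub>R 1 - x)"
  have "norm y \<le> 1" using tx t by (simp add: y_def)
  moreover have "star y = y"
    using upos_selfadjoint[OF assms] by (simp add: y_def star_diff star_scaleR)
  ultimately obtain s where s: "s * s = 1 - y" "star s = s" "norm (1 - s) \<le> 1"
    "\<And>z. z * y = y * z \<Longrightarrow> z * s = s * z"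
    using ex_sqrt_one_minus[of y] by blast
  have "1 - y = (1/t) *\<^sub>R x" using t by (simp add: y_def algebra_simps)
  then have "(sqrt t *\<^sub>R s) * (sqrt t *\<^sub>R s) = x" using s(1) t by simp
  moreover have "upos s" using s(2,3) unfolding upos_def by (intro conjI exI[of _ 1]) auto
  then have "upos (sqrt t *\<^sub>R s)" using t by (intro upos_scaleR) auto
  moreover have "z * (sqrt t *\<^sub>R s) = (sqrt t *\<^sub>R s) * z" if "z * x = x * z" for z
  proof -
    have "z * y = y * z" using that by (simp add: y_def algebra_simps)
    then show ?thesis using s(4) by simp
  qed
  ultimately show ?thesis using that by blast
qed

text \<open>Apply the C*-identity to the normal element \<open>p + i q\<close>.\<close>
lemma norm_square_le_sum_squares:
  fixes p q :: "'a::{cstar_algebra, real_normed_algebra_1}"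
  assumes "star p = p" "star q = q" "p * q = q * p"
  shows "(norm p)\<^sup>2 \<le> norm (p * p + q * q)"
proof -
  define n where "n = p + \<i> *\<^sub>C q"
  have sn: "star n = p - \<i> *\<^sub>C q"
    using assms by (simp add: n_def star_add star_scaleC scaleC_minus_left)
  have "star n * n = p * p + q * q"
    using assms(3) unfolding sn unfolding n_def
    by (simp add: algebra_simps scaleC_mult_left scaleC_mult_right scaleC_scaleC scaleC_minus_left
        scaleC_diff_right)
  then have n: "norm (p * p + q * q) = (norm n)\<^sup>2" by (metis cstar_identity)
  have "p + p = n + star n" unfolding sn unfolding n_def by simp
  then have "norm (p + p) \<le> norm n + norm n" by (metis norm_star norm_triangle_ineq)
  moreover have "norm (p + p) = 2 * norm p" by (simp flip: scaleR_2)
  ultimately show ?thesis unfolding n by (intro power_mono) auto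
qed

text \<open>For x in the unit ball, c = (1 - x^2)^(1/2) commutes with x, so the squared norm of c is
  at most the norm of c^2 + x^2 = 1. Hence 1 - x^2 = c^2 has norm at most 1.\<close>

lemma upos_square:
  fixes x :: "'a::{cstar_algebra, real_normed_algebra_1}"
  assumes x: "star x = x"
  shows "upos (x * x)"
proof -
  have unit: "upos (x * x)" if x: "star x = x" "norm x \<le> 1" for x :: 'a
  proof -
    have xx: "norm (x * x) \<le> 1"
      using norm_mult_ineq[of x x] x(2) mult_le_one[of "norm x" "norm x"] by simp
    have sx: "star (x * x) = x * x" using x by (simp add: star_mult)
    obtain c where c: "c * c = 1 - x * x" "star c = c"
      "\<And>z. z * (x * x) = x * x * z \<Longrightarrow> z * c = c * z"
      using ex_sqrt_one_minus[OF xx sx] by blast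
    have "x * c = c * x" by (rule c(3)) (simp add: mult.assoc)
    then have "(norm c)\<^sup>2 \<le> norm (c * c + x * x)"
      using x c(2) by (intro norm_square_le_sum_squares) auto
    moreover have "norm (c * c) = (norm c)\<^sup>2" using cstar_identity[of c] c(2) by simp
    ultimately have "norm (1 - x * x) \<le> 1" using c(1) by simp
    then show ?thesis unfolding upos_def using sx by (intro conjI exI[of _ 1]) auto
  qed
  show ?thesis
  proof (cases "x = 0")
    case False
    define y where "y = (1 / norm x) *\<^sub>R x"
    have "upos (y * y)" using x False by (intro unit) (simp_all add: y_def star_scaleR)
    then have "upos ((norm x * norm x) *\<^sub>R (y * y))" by (rule upos_scaleR) simp
    with False show ?thesis by (simp add: y_def)
  qed simp
qed

lemma upos_mult_commuting:
  assumes "upos x" "upos y" "x * y = y * x"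
  shows "upos (x * y)"
proof -
  obtain a where a: "upos a" "a * a = x" "\<And>z. z * x = x * z \<Longrightarrow> z * a = a * z"
    using ex_sqrt[OF assms(1)] by blast
  obtain b where b: "upos b" "b * b = y" "\<And>z. z * y = y * z \<Longrightarrow> z * b = b * z"
    using ex_sqrt[OF assms(2)] by blast
  have "a * b = b * a" using a(3) b(3) assms(3) by metis
  then have "x * y = (a * b) * (a * b)" "star (a * b) = a * b"
    using a b upos_selfadjoint by (metis mult.assoc, metis star_mult)
  then show ?thesis using upos_square[of "a * b"] by simp
qed

text \<open>Commuting roots a of x and c of 1 - x satisfy a^2 + c^2 = 1, which bounds a.\<close>

lemma norm_le_oneI:
  assumes "upos x" "upos (1 - x)"
  shows "norm x \<le> 1"
proof -
  obtain a where a: "upos a" "a * a = x" "\<And>z. z * x = x * z \<Longrightarrow> z * a = a * z"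
    using ex_sqrt[OF assms(1)] by blast
  obtain c where c: "upos c" "c * c = 1 - x" "\<And>z. z * (1 - x) = (1 - x) * z \<Longrightarrow> z * c = c * z"
    using ex_sqrt[OF assms(2)] by blast
  have "a * c = c * a"
    by (rule c(3)) (simp add: a(2)[symmetric] algebra_simps)
  then have "(norm a)\<^sup>2 \<le> norm (a * a + c * c)"
    using a(1) c(1) by (intro norm_square_le_sum_squares) (simp_all add: upos_selfadjoint)
  moreover have "norm x = (norm a)\<^sup>2"
    using cstar_identity[of a] a(2) upos_selfadjoint[OF a(1)] by simp
  ultimately show ?thesis by (simp add: a(2) c(2))
qed

lemma norm_leI:
  assumes "upos x" "upos (t *\<^sub>R 1 - x)" "0 < t"
  shows "norm x \<le> t"
proof -
  have "upos ((1/t) *\<^sub>R x)" "upos ((1/t) *\<^sub>R (t *\<^sub>R 1 - x))"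
    using assms by (auto intro!: upos_scaleR)
  then have "norm ((1/t) *\<^sub>R x) \<le> 1"
    using assms(3) by (intro norm_le_oneI) (simp_all add: scaleR_diff_right)
  then show ?thesis using assms(3) by (simp add: field_simps)
qed

lemma norm_mono:
  assumes "upos x" "upos (y - x)"
  shows "norm x \<le> norm y"
\<comment> \<open>\<open>norm_leI\<close> wants a positive bound, while \<open>norm y\<close> may be
  0.\<close>
proof (rule dense_ge)
  fix t assume t: "norm y < t"
  have "star y = y" using upos_selfadjoint[OF upos_add[OF assms]] by simp
  then have "upos ((t *\<^sub>R 1 - y) + (y - x))"
    using t assms by (intro upos_add upos_norm_minus) auto
  then show "norm x \<le> t"
    using t assms(1) norm_ge_zero[of y] by (intro norm_leI) (auto simp del: norm_ge_zero)
qed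

lemma upos_cube:
  assumes "upos x"
  shows "upos (x * x * x)"
  using upos_mult_commuting[OF upos_square[OF upos_selfadjoint[OF assms]] assms]
  by (simp add: mult.assoc)

text \<open>Let \<open>e = - b\<^sup>* b\<close> and \<open>d = b b\<^sup>*\<close>, which are both positive. Squaring
  \<open>norm (b (1 + e)) = norm ((1 - d) b) \<le> norm b\<close> gives \<open>norm (e (1 + e)\<^sup>2) \<le> norm e\<close>, whence \<open>e = 0\<close>.\<close>
lemma star_mult_self_negative_imp_0:
  fixes b :: "'a::{cstar_algebra, real_normed_algebra_1}"
  assumes e: "upos (- (star b * b))" and b: "norm b \<le> 1"
  shows "b = 0"
proof -
  define e where "e = - (star b * b)"
  define t where "t = norm e"
  have pe: "upos e" using e by (simp add: e_def)
  have te: "t = (norm b)\<^sup>2" by (simp add: t_def e_def cstar_identity)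
  \<comment> \<open>The real and imaginary parts of b: twice p^2 + q^2 equals b^* b + b b^*, so
    adding \<open>e\<close> leaves b b^* as a sum of positive elements.\<close>
  define p where "p = (1/2) *\<^sub>R (b + star b)"
  define q where "q = (1/2) *\<^sub>R (\<i> *\<^sub>C (star b - b))"
  have sp: "star p = p" by (simp add: p_def star_scaleR star_add star_star add.commute)
  have sq: "star q = q"
    by (simp add: q_def star_scaleR star_scaleC star_diff star_star scaleC_minus_left
        flip: scaleC_minus_right)
  have "2 *\<^sub>R (p * p + q * q) = star b * b + b * star b"
  proof -
    have "q * q = - ((1/4) *\<^sub>R ((star b - b) * (star b - b)))"
      by (simp add: q_def scaleC_mult_left scaleC_mult_right scaleC_scaleR scaleC_scaleC
          scaleC_minus_left)
    moreover have "p * p = (1/4) *\<^sub>R ((b + star b) * (b + star b))" by (simp add: p_def)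
    ultimately have "p * p + q * q
        = (1/4) *\<^sub>R ((b + star b) * (b + star b) - (star b - b) * (star b - b))"
      by (simp add: scaleR_diff_right)
    also have "(b + star b) * (b + star b) - (star b - b) * (star b - b)
        = 2 *\<^sub>R (star b * b + b * star b)"
      by (simp add: algebra_simps scaleR_2)
    finally show ?thesis by simp
  qed
  moreover have "upos (2 *\<^sub>R (p * p + q * q))"
    by (intro upos_scaleR upos_add upos_square sp sq) simp
  ultimately have "upos ((star b * b + b * star b) + e)"
    using upos_add pe by metis
  then have d: "upos (b * star b)" by (simp add: e_def)
  have nd: "norm (b * star b) \<le> 1"
    using norm_mult_ineq[of b "star b"] b mult_le_one[of "norm b" "norm b"] by simp
  have "upos (1 - b * star b)"
    using upos_norm_minus[OF upos_selfadjoint[OF d] nd] by simp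
  then have "norm (1 - b * star b) \<le> 1" using d by (intro norm_le_oneI) simp_all
  then have "norm ((1 - b * star b) * b) \<le> norm b"
    using norm_mult_ineq[of "1 - b * star b" b] mult_right_mono[of "norm (1 - b * star b)" 1 "norm b"]
    by simp
  moreover have "(1 - b * star b) * b = b * (1 + e)" by (simp add: e_def algebra_simps)
  ultimately have "(norm (b * (1 + e)))\<^sup>2 \<le> t" unfolding te by (simp add: power_mono)
  moreover have "star (b * (1 + e)) * (b * (1 + e)) = - (e + 2 *\<^sub>R (e * e) + e * e * e)"
  proof -
    have "star (b * (1 + e)) * (b * (1 + e)) = (1 + e) * (star b * b) * (1 + e)"
      using upos_selfadjoint[OF pe] by (simp add: star_mult star_add mult.assoc)
    also have "star b * b = - e" by (simp add: e_def)
    finally show ?thesis by (simp add: algebra_simps scaleR_2)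
  qed
  ultimately have "norm (e + 2 *\<^sub>R (e * e) + e * e * e) \<le> t"
    by (metis cstar_identity norm_minus_cancel)
  moreover have "upos (e + 2 *\<^sub>R (e * e) + e * e * e)"
    by (intro upos_add upos_scaleR upos_square upos_cube upos_selfadjoint pe) simp
  ultimately have "upos (t *\<^sub>R 1 - (e + 2 *\<^sub>R (e * e) + e * e * e))"
    by (intro upos_norm_minus upos_selfadjoint)
  \<comment> \<open>Adding e^3 and 2 (t - e)^2 removes all nonlinear terms and leaves (1 + 4t) e <=
    t + 2t^2. Taking norms gives 2t^2 <= 0.\<close>
  moreover have "upos (2 *\<^sub>R ((t *\<^sub>R 1 - e) * (t *\<^sub>R 1 - e)))"
    using upos_selfadjoint[OF pe] by (intro upos_scaleR upos_square) (simp_all add: star_diff star_scaleR)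
  ultimately have "upos ((t *\<^sub>R 1 - (e + 2 *\<^sub>R (e * e) + e * e * e)) + e * e * e
      + 2 *\<^sub>R ((t *\<^sub>R 1 - e) * (t *\<^sub>R 1 - e)))"
    by (intro upos_add upos_cube pe)
  also have "(t *\<^sub>R 1 - (e + 2 *\<^sub>R (e * e) + e * e * e)) + e * e * e
      + 2 *\<^sub>R ((t *\<^sub>R 1 - e) * (t *\<^sub>R 1 - e)) = (t + 2 * t * t) *\<^sub>R 1 - (1 + 4 * t) *\<^sub>R e"
    by (simp add: algebra_simps) (simp flip: scaleR_add_left add: add.assoc[symmetric])
  finally have *: "upos ((t + 2 * t * t) *\<^sub>R 1 - (1 + 4 * t) *\<^sub>R e)" .
  have "t = 0"
  proof (rule ccontr)
    assume "t \<noteq> 0"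
    then have t: "0 < t" by (simp add: t_def)
    have "norm ((1 + 4 * t) *\<^sub>R e) \<le> t + 2 * t * t"
      using * t pe by (intro norm_leI upos_scaleR) (auto intro: add_pos_pos)
    then have "(1 + 4 * t) * t \<le> t + 2 * t * t" using t by (simp add: t_def)
    then have "t * t \<le> 0" by (simp add: algebra_simps)
    then show False using t by (simp add: mult_le_0_iff)
  qed
  then show ?thesis using te by simp
qed

text \<open>With \<open>x = a\<^sup>* a\<close> and \<open>q = abs x - x\<close> the element \<open>b = a q\<close> satisfies \<open>b\<^sup>* b = - (abs x) q\<^sup>2 \<le> 0\<close>.\<close>
lemma upos_star_mult_self:
  fixes a :: "'a::{cstar_algebra, real_normed_algebra_1}"
  shows "upos (star a * a)"
proof -
  define x where "x = star a * a"
  have sx: "star x = x" by (simp add: x_def star_mult star_star)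
  obtain m where m: "upos m" "m * m = x * x" "\<And>z. z * (x * x) = x * x * z \<Longrightarrow> z * m = m * z"
    using ex_sqrt[OF upos_square[OF sx]] by blast
  have xm: "x * m = m * x" by (rule m(3)) (simp add: mult.assoc)
  define q where "q = m - x"
  have sq: "star q = q" using sx upos_selfadjoint[OF m(1)] by (simp add: q_def star_diff)
  have xq: "x * q = - (m * q)" using m(2) xm by (simp add: q_def algebra_simps)
  have qm: "q * m = m * q" using xm by (simp add: q_def algebra_simps)
  define b where "b = (1 / (norm (a * q) + 1)) *\<^sub>R (a * q)"
  have n1: "norm (a * q) + 1 > 0" using norm_ge_zero[of "a * q"] by linarith
  have "star (a * q) * (a * q) = q * (x * q)" by (simp add: star_mult sq x_def mult.assoc)
  also have "\<dots> = - (m * (q * q))" unfolding xq by (simp add: mult.assoc[symmetric] qm)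
  finally have aq: "star (a * q) * (a * q) = - (m * (q * q))" .
  have pm: "upos (m * (q * q))"
    using qm by (intro upos_mult_commuting[OF m(1) upos_square[OF sq]]) (metis mult.assoc)
  have "- (star b * b) = (1 / (norm (a * q) + 1))\<^sup>2 *\<^sub>R (m * (q * q))"
    by (simp add: b_def star_scaleR aq power2_eq_square)
  then have "upos (- (star b * b))" using pm by (simp add: upos_scaleR)
  moreover have "norm b \<le> 1" using n1 by (simp add: b_def)
  ultimately have "b = 0" by (rule star_mult_self_negative_imp_0)
  then have "a * q = 0" using n1 by (simp add: b_def)
  then have mqq: "m * (q * q) = 0" "x * q = 0" using aq by (simp_all add: x_def mult.assoc)
  \<comment> \<open>Since x q = 0, q^2 = m q and q^3 = m q^2 = 0; a self-adjoint nilpotent element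
    vanishes by the C*-identity.\<close>
  have "q * q = m * q" using mqq(2) by (simp add: q_def[of] left_diff_distrib)
  then have "(q * q) * q = 0" using mqq by (simp add: mult.assoc)
  then have "star (q * q) * (q * q) = 0" by (simp add: star_mult sq mult.assoc)
  then have "star q * q = 0" using star_mult_self_eq_0 sq by metis
  then have "q = 0" by simp
  then show ?thesis using m(1) by (simp add: q_def x_def)
qed

section \<open>Order estimates and decay rates\<close>

lemma upos_conj: "upos x \<Longrightarrow> upos (star c * x * c)"
proof -
  assume "upos x"
  then obtain s where "upos s" "s * s = x" using ex_sqrt by blast
  then have "star c * x * c = star (s * c) * (s * c)"
    using upos_selfadjoint[of s] by (auto simp: star_mult mult.assoc)
  then show ?thesis by (simp add: upos_star_mult_self)
qed

lemma upos_norm_bound: "upos ((norm b)\<^sup>2 *\<^sub>R (star c * c) - star (b * c) * (b * c))"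
proof -
  have "upos ((norm b)\<^sup>2 *\<^sub>R 1 - star b * b)"
    by (rule upos_norm_minus) (simp_all add: star_mult star_star cstar_identity)
  then have "upos (star c * ((norm b)\<^sup>2 *\<^sub>R 1 - star b * b) * c)" by (rule upos_conj)
  then show ?thesis by (simp add: algebra_simps star_mult)
qed

text \<open>Turns domination in order into domination in norm after multiplication by any
  \<open>u\<close>. With \<open>u\<close> a power of 1 - l^2 it transfers decay rates from l^3 to
  z.\<close>

lemma norm_le_of_pos_diff:
  assumes "upos (C *\<^sub>R (star y * y) - star x * x)" "0 \<le> C"
  shows "norm (x * u) \<le> sqrt C * norm (y * u)"
proof -
  have "upos (star u * (C *\<^sub>R (star y * y) - star x * x) * u)" using assms(1) by (rule upos_conj)
  then have "upos (C *\<^sub>R (star (y * u) * (y * u)) - star (x * u) * (x * u))"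
    by (simp add: algebra_simps star_mult)
  then have "norm (star (x * u) * (x * u)) \<le> norm (C *\<^sub>R (star (y * u) * (y * u)))"
    by (intro norm_mono upos_star_mult_self)
  then have "(norm (x * u))\<^sup>2 \<le> C * (norm (y * u))\<^sup>2"
    using assms(2) by (simp add: cstar_identity)
  also have "\<dots> = (sqrt C * norm (y * u))\<^sup>2" using assms(2) by (simp add: power_mult_distrib)
  finally show ?thesis by (rule power2_le_imp_le) (use assms(2) in simp)
qed

lemma upos_power: "upos x \<Longrightarrow> upos (x ^ n)"
proof (induction n)
  case 0
  show ?case using upos_square[of 1] by simp
next
  case (Suc n)
  then show ?case by (simp add: upos_mult_commuting power_commutes)
qed

text \<open>The \<open>n + 1\<close> summands of \<open>\<Sum>j\<le>n. k (1 - k)\<^sup>j = 1 - (1 - k)\<^sup>n\<^sup>+\<^sup>1 \<le> 1\<close> decrease.\<close>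
lemma norm_mult_one_minus_power_le:
  fixes k :: "'a::{cstar_algebra, real_normed_algebra_1}"
  assumes "upos k" "norm k \<le> 1"
  shows "norm (k * (1 - k) ^ n) \<le> 1 / (real n + 1)"
proof -
  define w where "w = 1 - k"
  have w: "upos w" using upos_norm_minus[OF upos_selfadjoint] assms by (fastforce simp: w_def)
  have kw: "k * w ^ n = w ^ n * k" for n
    by (rule power_commuting_commutes[symmetric]) (simp add: w_def algebra_simps)
  have pw: "upos (k * w ^ n)" for n
    by (intro upos_mult_commuting assms upos_power w kw)
  have "upos (1 - w ^ Suc n - (real n + 1) *\<^sub>R (k * w ^ n))"
  proof (induction n)
    case 0
    show ?case by (simp add: w_def)
  next
    case (Suc n)
    \<comment> \<open>k^2 w^n is the gap between the consecutive summands k w^n and k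
      w^(n+1).\<close>
    have "upos ((k * k) * w ^ n)"
      by (intro upos_mult_commuting upos_square upos_selfadjoint upos_power w assms) (metis kw mult.assoc)
    then have "upos ((1 - w ^ Suc n - (real n + 1) *\<^sub>R (k * w ^ n)) + (real n + 1) *\<^sub>R ((k * k) * w ^ n))"
      using Suc by (intro upos_add upos_scaleR) auto
    moreover have W: "w ^ Suc m = w ^ m - k * w ^ m" for m
      by (simp add: w_def left_diff_distrib)
    have "1 - w ^ Suc (Suc n) - (real (Suc n) + 1) *\<^sub>R (k * w ^ Suc n)
        = (1 - w ^ Suc n - (real n + 1) *\<^sub>R (k * w ^ n)) + (real n + 1) *\<^sub>R ((k * k) * w ^ n)"
      unfolding W[of "Suc n"] W[of n] by (simp add: algebra_simps scaleR_2)
    ultimately show ?case by (simp only:)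
  qed
  then have "upos ((1 - w ^ Suc n - (real n + 1) *\<^sub>R (k * w ^ n)) + w ^ Suc n)"
    by (intro upos_add upos_power w)
  then have "upos (1 *\<^sub>R 1 - (real n + 1) *\<^sub>R (k * w ^ n))" by simp
  then have "norm ((real n + 1) *\<^sub>R (k * w ^ n)) \<le> 1"
    by (intro norm_leI upos_scaleR pw) auto
  then have "(real n + 1) * norm (k * w ^ n) \<le> 1" unfolding norm_scaleR by simp
  then show ?thesis by (simp add: w_def field_simps)
qed

text \<open>With w = 1 - l^2, split into l^2 w^n, of order 1/n, and l w^n, of order n^(-1/2) by the
  C*-identity. The third factor l makes the rate summable: the bound for l^2 alone is of order
  1/n.\<close>

lemma norm_cube_mult_one_minus_power_le:
  fixes l :: "'a::{cstar_algebra, real_normed_algebra_1}"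
  assumes l: "star l = l" "norm l \<le> 1"
  shows "norm (l * l * l * (1 - l * l) ^ (2 * n)) \<le> (real n + 1) powr (- 3 / 2)"
proof -
  define k where "k = l * l"
  define w where "w = 1 - k"
  have k: "upos k" "norm k \<le> 1"
    using l norm_mult_ineq[of l l] mult_le_one[of "norm l" "norm l"] by (auto simp: k_def upos_square)
  have lw: "l * w ^ m = w ^ m * l" for m
    by (rule power_commuting_commutes[symmetric]) (simp add: w_def k_def algebra_simps)
  have sw: "star (w ^ m) = w ^ m" for m
    using l by (induction m) (simp_all add: w_def k_def star_mult star_diff power_commutes)
  have b: "norm (k * w ^ m) \<le> 1 / (real m + 1)" for m
    using norm_mult_one_minus_power_le[OF k] by (simp add: w_def)
  have "star (l * w ^ n) * (l * w ^ n) = l * (w ^ n * l) * w ^ n"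
    by (simp add: star_mult l(1) sw mult.assoc) (metis lw mult.assoc)
  also have "\<dots> = k * w ^ (2 * n)"
    by (simp add: lw[symmetric] k_def mult_2 power_add mult.assoc)
  finally have "(norm (l * w ^ n))\<^sup>2 = norm (k * w ^ (2 * n))"
    by (metis cstar_identity)
  also have "\<dots> \<le> 1 / (real (2 * n) + 1)" by (rule b)
  also have "\<dots> \<le> 1 / (real n + 1)" by (simp add: frac_le)
  also have "\<dots> = ((real n + 1) powr (- 1 / 2))\<^sup>2"
    by (simp add: power2_eq_square powr_minus field_simps flip: powr_add)
  finally have lb: "norm (l * w ^ n) \<le> (real n + 1) powr (- 1 / 2)"
    by (rule power2_le_imp_le) simp
  have "l * l * l * w ^ (2 * n) = (k * w ^ n) * (l * w ^ n)"
    by (simp add: k_def mult_2 power_add mult.assoc) (metis lw mult.assoc)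
  then have "norm (l * l * l * w ^ (2 * n)) \<le> norm (k * w ^ n) * norm (l * w ^ n)"
    by (metis norm_mult_ineq)
  also have "\<dots> \<le> (1 / (real n + 1)) * (real n + 1) powr (- 1 / 2)"
    by (intro mult_mono b lb) auto
  also have "\<dots> = (real n + 1) powr (- 1) * (real n + 1) powr (- 1 / 2)"
    by (simp add: powr_minus field_simps)
  also have "\<dots> = (real n + 1) powr (- 3 / 2)" unfolding powr_add[symmetric] by simp
  finally show ?thesis by (simp add: w_def k_def)
qed

subsection \<open>Positivity and factorization without a unit\<close>

definition emb :: "'a::cstar_algebra \<Rightarrow> 'a unitization"
  where "emb x = Unitization x 0"

lemma emb_simps: "emb (x + y) = emb x + emb y" "emb (x - y) = emb x - emb y"
  "emb (x * y) = emb x * emb y" "emb (r *\<^sub>R x) = r *\<^sub>R emb x" "emb (star x) = star (emb x)"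
  "emb 0 = 0"
  by (simp_all add: emb_def unitization_eq_iff unitization_defs unitization_cstar_defs)

lemma emb_eq_iff: "emb x = emb y \<longleftrightarrow> x = y"
  by (simp add: emb_def)

lemma norm_emb: "norm (emb x) = norm x"
proof (rule antisym)
  show "norm (emb x) \<le> norm x" using norm_unitization_le[of "emb x"] by (simp add: emb_def)
  show "norm x \<le> norm (emb x)"
  proof (cases "x = 0")
    case False
    have "norm x * norm x = norm (lrep (emb x) (star x))"
      using cstar_identity[of "star x"] by (simp add: lrep_def emb_def star_star power2_eq_square)
    then have "norm x * norm x \<le> norm (emb x) * norm x"
      using norm_lrep_le[of "emb x" "star x"] by simp
    then show ?thesis using False by simp
  qed simp
qed

definition pos :: "'a::cstar_algebra \<Rightarrow> bool"
  where "pos x \<longleftrightarrow> upos (emb x)"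

lemma pos_zero [simp]: "pos 0"
  by (simp add: pos_def emb_simps)

lemma pos_add: "pos x \<Longrightarrow> pos y \<Longrightarrow> pos (x + y)"
  by (simp add: pos_def emb_simps upos_add)

lemma pos_scaleR: "pos x \<Longrightarrow> 0 \<le> r \<Longrightarrow> pos (r *\<^sub>R x)"
  by (simp add: pos_def emb_simps upos_scaleR)

lemma pos_star_mult_self: "pos (star x * x)"
  by (simp add: pos_def emb_simps upos_star_mult_self)

lemma pos_conj: "pos x \<Longrightarrow> pos (star c * x * c)"
  by (simp add: pos_def emb_simps upos_conj)

lemma pos_selfadjoint: "pos x \<Longrightarrow> star x = x"
  using upos_selfadjoint[of "emb x"] by (simp add: pos_def emb_eq_iff flip: emb_simps)

lemma pos_norm_bound: "pos ((norm b)\<^sup>2 *\<^sub>R (star c * c) - star (b * c) * (b * c))"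
  using upos_norm_bound[of "emb b" "emb c"] by (simp add: pos_def emb_simps norm_emb)

text \<open>The root taken in the unitization has a scalar part with square 0, so it already lies in
  the algebra.\<close>

lemma pos_ex_sqrt:
  assumes "pos x"
  obtains s where "pos s" "s * s = x"
proof -
  obtain s where s: "upos s" "s * s = emb x"
    using ex_sqrt assms unfolding pos_def by blast
  have "scal_part (s * s) = 0" using s(2) by (simp add: emb_def)
  then have "scal_part s = 0" by (simp add: unitization_defs)
  then have "s = emb (vec_part s)" by (simp add: emb_def unitization_eq_iff)
  then show ?thesis using that s by (metis pos_def emb_simps(3) emb_eq_iff)
qed

text \<open>The factor is the Neumann series \<open>r = z (l\<^sup>2)\<^sup>-\<^sup>1 = z \<Sum>n. (1 - l\<^sup>2)\<^sup>n\<close>, summed in pairs; its terms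
  are of order \<open>n\<^sup>-\<^sup>3\<^sup>/\<^sup>2\<close>.\<close>
lemma factorization_unit_ball:
  fixes l z :: "'a::cstar_algebra"
  assumes l: "star l = l" "norm l \<le> 1" and C: "0 \<le> C"
    and z: "pos (C *\<^sub>R (l * l * l * (l * l * l)) - star z * z)"
  obtains r where "z = r * (l * l)"
proof -
  \<comment> \<open>This is 1 - (1 - l^2)^2 written without a unit. Each step of \<open>Z\<close>
    thus multiplies by (1 - l^2)^2, matching the even exponents of the decay estimate.\<close>
  define k where "k = l * l + l * l - l * l * (l * l)"
  define Z where "Z = rec_nat z (\<lambda>_ x. x - x * k)"
  have Z: "Z 0 = z" "Z (Suc n) = Z n - Z n * k" for n by (simp_all add: Z_def)
  have Zemb: "emb (Z n) = emb z * (1 - emb l * emb l) ^ (2 * n)" for n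
  proof (induction n)
    case (Suc n)
    have "emb (Z (Suc n)) = emb (Z n) * ((1 - emb l * emb l) * (1 - emb l * emb l))"
      by (simp add: Z k_def emb_simps algebra_simps)
    also have "\<dots> = emb z * ((1 - emb l * emb l) ^ (2 * n) * ((1 - emb l * emb l) * (1 - emb l * emb l)))"
      by (simp add: Suc mult.assoc)
    also have "(1 - emb l * emb l) ^ (2 * n) * ((1 - emb l * emb l) * (1 - emb l * emb l))
        = (1 - emb l * emb l) ^ (2 * Suc n)"
      unfolding mult_Suc_right add.commute[of 2] power_add by (simp add: power2_eq_square)
    finally show ?case .
  qed (simp add: Z)
  have "norm (Z n) \<le> sqrt C * (real (Suc n) powr (- 3 / 2))" for n
  proof -
    have "norm (Z n) = norm (emb z * (1 - emb l * emb l) ^ (2 * n))"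
      by (simp only: Zemb[symmetric] norm_emb)
    also have "\<dots> \<le> sqrt C * norm (emb (l * l * l) * (1 - emb l * emb l) ^ (2 * n))"
      using z l C by (intro norm_le_of_pos_diff)
        (simp_all add: pos_def emb_simps mult.assoc star_mult flip: emb_simps(5))
    also have "\<dots> \<le> sqrt C * (real n + 1) powr (- 3 / 2)"
      using norm_cube_mult_one_minus_power_le[of "emb l" n] l C
      by (intro mult_left_mono) (simp_all add: emb_simps norm_emb flip: emb_simps(5))
    finally show ?thesis by (simp add: add.commute)
  qed
  moreover have "summable (\<lambda>n. real n powr (- 3 / 2))"
    by (simp add: summable_real_powr_iff)
  then have "summable (\<lambda>n. sqrt C * real (Suc n) powr (- 3 / 2))"
    by (intro summable_mult) (subst summable_Suc_iff)
  ultimately have sZ: "summable Z" by (blast intro: summable_comparison_test')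
  define r where "r = suminf Z"
  have "(\<lambda>n. Z n * k) sums (r * k)"
    unfolding r_def by (rule sums_mult2[OF summable_sums[OF sZ]])
  moreover have "(\<lambda>n. Z n - Z (Suc n)) sums (Z 0 - 0)"
    by (rule telescope_sums'[OF summable_LIMSEQ_zero[OF sZ]])
  then have "(\<lambda>n. Z n * k) sums z" by (simp add: Z)
  ultimately have "z = r * k" by (rule sums_unique2[symmetric])
  then have "z = (r + r - r * (l * l)) * (l * l)"
    by (simp add: k_def algebra_simps)
  then show ?thesis using that by blast
qed

lemma factorization:
  fixes l z :: "'a::cstar_algebra"
  assumes l: "star l = l" and C: "0 \<le> C"
    and z: "pos (C *\<^sub>R (l * l * l * (l * l * l)) - star z * z)"
  obtains r where "z = r * (l * l)"
proof -
  define s where "s = norm l + 1"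
  have s: "0 < s" "norm l \<le> s" by (simp_all add: s_def add_nonneg_pos)
  define m where "m = (1 / s) *\<^sub>R l"
  have lm: "l = s *\<^sub>R m" using s by (simp add: m_def)
  have "star m = m" using l by (simp add: m_def star_scaleR)
  moreover have "norm m \<le> 1" using s by (simp add: m_def)
  moreover have "0 \<le> C * s ^ 6" using C s by simp
  moreover have "pos ((C * s ^ 6) *\<^sub>R (m * m * m * (m * m * m)) - star z * z)"
    using z unfolding lm by (simp add: power_numeral_reduce mult.assoc)
  ultimately obtain r where "z = r * (m * m)" by (rule factorization_unit_ball)
  then have "z = (1 / s / s) *\<^sub>R r * (l * l)" using s by (simp add: lm)
  then show ?thesis using that by blast
qed

lemma pos_diff_trans: "pos (y - x) \<Longrightarrow> pos (z - y) \<Longrightarrow> pos (z - x)"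
  using pos_add by fastforce

text \<open>Repeated square roots produce exponents that are powers of 2, never multiples of 6. The
  commuting factor \<open>b\<close> takes up the surplus, as in 8 = 2 + 6, 32 = 2 + 30 or 64 = 4 +
  60.\<close>

lemma factorization_of_le:
  fixes b l z :: "'a::cstar_algebra"
  assumes "star b = b" "star l = l" "b * l = l * b" "0 \<le> C"
    and "pos (C *\<^sub>R (b * b * (l * l * l * (l * l * l))) - star z * z)"
  obtains r where "z = r * (l * l)"
proof -
  have "star (b * (l * l * l)) * (b * (l * l * l)) = b * b * (l * l * l * (l * l * l))"
    using assms(1-3) by (simp add: star_mult mult.assoc) (metis mult.assoc)
  moreover have "star (l * l * l) * (l * l * l) = l * l * l * (l * l * l)"
    using assms(2) by (simp add: star_mult mult.assoc)
  ultimately have "pos (C *\<^sub>R ((norm b)\<^sup>2 *\<^sub>R (l * l * l * (l * l * l)) - b * b * (l * l * l * (l * l * l))))"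
    using pos_norm_bound[of b "l * l * l"] assms(4) by (intro pos_scaleR) simp_all
  then have "pos ((C * (norm b)\<^sup>2) *\<^sub>R (l * l * l * (l * l * l)) - star z * z)"
    using pos_diff_trans[OF assms(5)] by (simp add: scaleR_diff_right)
  then show ?thesis
    using factorization[OF assms(2), of "C * (norm b)\<^sup>2" z] assms(4) that by auto
qed

subsection \<open>Ideals closed under square roots\<close>

definition root_closed :: "'a::cstar_algebra set \<Rightarrow> bool"
  where "root_closed I \<longleftrightarrow> (\<forall>p. pos p \<longrightarrow> p * p \<in> I \<longrightarrow> p \<in> I)"

lemma is_ideal_mult:
  assumes "is_ideal I" "x \<in> I"
  shows "a * x \<in> I" "x * a \<in> I"
  using assms by (auto simp: is_ideal_def)

lemma is_ideal_add: "is_ideal I \<Longrightarrow> x \<in> I \<Longrightarrow> y \<in> I \<Longrightarrow> x + y \<in> I"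
  by (auto simp: is_ideal_def)

text \<open>Here n = k^(1/8) stays in I by root closedness, and k = n^2 n^6 fits
  \<open>factorization_of_le\<close> with b = l = n.\<close>

lemma root_closed_factorization:
  assumes I: "is_ideal I" "root_closed I" and k: "k \<in> I" "pos k" "pos (k - star z * z)"
  obtains r n where "z = r * (n * n)" "star n = n" "n \<in> I"
proof -
  obtain n2 where n2: "pos n2" "n2 * n2 = k" using pos_ex_sqrt[OF k(2)] .
  obtain n1 where n1: "pos n1" "n1 * n1 = n2" using pos_ex_sqrt[OF n2(1)] .
  obtain n where n: "pos n" "n * n = n1" using pos_ex_sqrt[OF n1(1)] .
  have "n \<in> I" using I n n1 n2 k unfolding root_closed_def by blast
  moreover have "k = n * n * (n * n * n * (n * n * n))"
    by (simp add: mult.assoc flip: n(2) n1(2) n2(2))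
  then obtain r where "z = r * (n * n)"
    using factorization_of_le[of n n 1 z] k pos_selfadjoint[OF n(1)] by auto
  ultimately show ?thesis using that pos_selfadjoint[OF n(1)] by blast
qed

text \<open>Root closedness thus makes an ideal hereditary, a property that closed ideals have
  automatically.\<close>

lemma root_closed_mem:
  assumes "is_ideal I" "root_closed I" "k \<in> I" "pos k" "pos (k - star z * z)"
  shows "z \<in> I"
  using root_closed_factorization[OF assms] is_ideal_mult[OF assms(1)] by metis

text \<open>With \<open>N = {z. x A z \<subseteq> I}\<close> and \<open>J = {z. z N \<subseteq> I}\<close>, the ideal \<open>J \<inter> N\<close> contains \<open>x\<close> and has square
  in \<open>I\<close>.\<close>
lemma semiprime_ideal_elementwise:
  assumes "semiprime_ideal I" "x * x \<in> I" "\<And>a. x * a * x \<in> I"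
  shows "x \<in> I"
proof -
  have I: "is_ideal I" using assms(1) by (simp add: semiprime_ideal_def)
  \<comment> \<open>The clause on \<open>x * z\<close> plays the part of a = 1, as the algebra may
    lack a unit.\<close>
  define N where "N = {z. x * z \<in> I \<and> (\<forall>a. x * a * z \<in> I)}"
  define J where "J = {z. \<forall>n\<in>N. z * n \<in> I}"
  have N: "is_ideal N"
    using I unfolding is_ideal_def N_def
    by (simp add: distrib_left) (metis mult.assoc)
  have J: "is_ideal J"
    using I N unfolding is_ideal_def J_def
    by (simp add: distrib_right) (metis mult.assoc)
  have "is_ideal (J \<inter> N)" using I N J by (simp add: is_ideal_def)
  moreover have "ideal_square (J \<inter> N) \<subseteq> I"
  proof
    fix y assume "y \<in> ideal_square (J \<inter> N)"
    then show "y \<in> I"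
      unfolding ideal_square_def
    proof (induction rule: group_closure.induct)
      case (diff s t)
      then show ?case using I unfolding is_ideal_def by (metis diff_conv_add_uminus)
    qed (use I in \<open>auto simp: J_def is_ideal_def\<close>)
  qed
  ultimately have "J \<inter> N \<subseteq> I" using assms(1) by (simp add: semiprime_ideal_def)
  moreover have "x \<in> J \<inter> N" using assms(2,3) by (simp add: J_def N_def)
  ultimately show ?thesis by blast
qed

text \<open>By polarization \<open>x a x\<close> is a combination of elements \<open>w\<^sup>* w \<le> C x\<^sup>2\<close>, where \<open>x = l\<^sup>3\<close>. The square
  root of such an element factors through \<open>l\<^sup>2\<close> on either side, so that \<open>w\<^sup>* w = r l\<^sup>4 r\<^sup>*\<close>.\<close>
lemma semiprime_ideal_cube:
  fixes l :: "'a::cstar_algebra"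
  assumes sp: "semiprime_ideal I" and l: "star l = l" and l4: "l * l * l * l \<in> I"
  shows "l * l * l \<in> I"
proof -
  have I: "is_ideal I" using sp by (simp add: semiprime_ideal_def)
  define x where "x = l * l * l"
  have sx: "star x = x" by (simp add: x_def star_mult l mult.assoc)
  \<comment> \<open>The scalar \<open>d\<close> will be a polarization coefficient; it is moved onto
    the cofactor \<open>r\<close>.\<close>
  have mem: "d *\<^sub>C (star w * w) \<in> I" if C: "0 \<le> C" "pos (C *\<^sub>R (x * x) - star w * w)" for C d w
  proof -
    obtain a where a: "pos a" "a * a = star w * w" using pos_ex_sqrt[OF pos_star_mult_self] .
    have sa: "star a = a" by (rule pos_selfadjoint[OF a(1)])
    obtain r where r: "a = r * (l * l)"
      using factorization[OF l C(1), of a] C(2) by (auto simp: x_def sa a(2))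
    have "star w * w = a * star a" by (simp add: sa a(2))
    also have "\<dots> = r * (l * l * l * l) * star r" by (simp add: r star_mult l mult.assoc)
    finally have "d *\<^sub>C (star w * w) = (d *\<^sub>C r) * (l * l * l * l) * star r"
      by (simp add: scaleC_mult_left)
    then show ?thesis using is_ideal_mult[OF I] l4 by metis
  qed
  have "x * a * x \<in> I" for a
  proof -
    define T where "T c = star (a * x + c *\<^sub>C x) * (a * x + c *\<^sub>C x)" for c
    have T: "d *\<^sub>C T c \<in> I" if "cmod c = 1" for c d
    proof -
      have cc: "cnj c * c = 1" "c * cnj c = 1"
        using that complex_norm_square[of c] by (simp_all add: mult.commute)
      have b1: "pos (2 *\<^sub>R ((norm a)\<^sup>2 *\<^sub>R (x * x) - star (a * x) * (a * x)))"
        using pos_norm_bound[of a x] sx by (intro pos_scaleR) simp_all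
      have b2: "pos (star (a * x - c *\<^sub>C x) * (a * x - c *\<^sub>C x))" by (rule pos_star_mult_self)
      \<comment> \<open>The parallelogram law for \<open>a * x\<close> and
        \<open>c *\<^sub>C x\<close> bounds \<open>T c\<close> by a multiple of x^2.\<close>
      have "(2 * (norm a)\<^sup>2 + 2) *\<^sub>R (x * x) - T c
        = 2 *\<^sub>R ((norm a)\<^sup>2 *\<^sub>R (x * x) - star (a * x) * (a * x))
          + star (a * x - c *\<^sub>C x) * (a * x - c *\<^sub>C x)"
        by (simp add: T_def star_add star_diff star_scaleC sx scaleR_2 algebra_simps
            scaleC_mult_left scaleC_mult_right scaleC_scaleC scaleC_diff_right scaleC_add_right cc)
      then have "pos ((2 * (norm a)\<^sup>2 + 2) *\<^sub>R (x * x) - T c)" using pos_add[OF b1 b2] by simp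
      then show ?thesis unfolding T_def by (intro mem) auto
    qed
    \<comment> \<open>Over the fourth roots of unity c, the weights c/4 isolate the term of
      \<open>T c\<close> carrying the conjugate of c: both c and c^2 sum to 0.\<close>
    have "x * a * x = (1/4) *\<^sub>C T 1 + (\<i>/4) *\<^sub>C T \<i> + (-1/4) *\<^sub>C T (-1) + (-\<i>/4) *\<^sub>C T (-\<i>)"
    proof -
      have T': "d *\<^sub>C T c = d *\<^sub>C (star (a * x) * (a * x)) + (d * c) *\<^sub>C (star (a * x) * x)
        + (d * cnj c) *\<^sub>C (x * (a * x)) + (d * (c * cnj c)) *\<^sub>C (x * x)" for c d
        by (simp add: T_def star_add star_scaleC sx distrib_left distrib_right scaleC_add_right
            scaleC_mult_left scaleC_mult_right scaleC_scaleC add.assoc)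
      have "(1/4) *\<^sub>C T 1 + (\<i>/4) *\<^sub>C T \<i> + (-1/4) *\<^sub>C T (-1) + (-\<i>/4) *\<^sub>C T (-\<i>)
        = (1/4) *\<^sub>C (x * (a * x)) + (1/4) *\<^sub>C (x * (a * x)) + (1/4) *\<^sub>C (x * (a * x))
          + (1/4) *\<^sub>C (x * (a * x))"
        unfolding T' by (simp add: scaleC_minus_left)
      then show ?thesis by (simp add: mult.assoc flip: scaleC_add_left)
    qed
    then show ?thesis using T by (simp add: is_ideal_add[OF I])
  qed
  moreover have "x * x \<in> I"
    using is_ideal_mult(2)[OF I l4, of "l * l"] by (simp add: x_def mult.assoc)
  ultimately have "x \<in> I" using semiprime_ideal_elementwise[OF sp] by blast
  then show ?thesis by (simp add: x_def)
qed

text \<open>Writing \<open>p = c\<^sup>1\<^sup>6\<close>, the powers of \<open>c\<close> known to lie in \<open>I\<close> are successively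
  32, 24, 18 (hence 20) and 15.\<close>
lemma semiprime_ideal_root_closed:
  assumes sp: "semiprime_ideal I"
  shows "root_closed I"
  unfolding root_closed_def
proof (intro allI impI)
  fix p :: 'a assume p: "pos p" "p * p \<in> I"
  have I: "is_ideal I" using sp by (simp add: semiprime_ideal_def)
  obtain c3 where c3: "pos c3" "c3 * c3 = p" using pos_ex_sqrt[OF p(1)] .
  obtain c2 where c2: "pos c2" "c2 * c2 = c3" using pos_ex_sqrt[OF c3(1)] .
  obtain c1 where c1: "pos c1" "c1 * c1 = c2" using pos_ex_sqrt[OF c2(1)] .
  obtain c where c: "pos c" "c * c = c1" using pos_ex_sqrt[OF c1(1)] .
  note cs = c(2)[symmetric] c1(2)[symmetric] c2(2)[symmetric] c3(2)[symmetric]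
  have sc: "star c = c" by (rule pos_selfadjoint[OF c(1)])
  note cube = semiprime_ideal_cube[OF sp]
  have "c3 * c3 * c3 * c3 \<in> I" using p(2) by (simp add: c3(2)[symmetric] mult.assoc)
  then have 24: "c3 * c3 * c3 \<in> I" by (intro cube pos_selfadjoint c3)
  define d where "d = c1 * c1 * c1"
  have "d * d * d * d \<in> I" using 24 by (simp add: d_def cs mult.assoc)
  moreover have "star d = d" by (simp add: d_def cs star_mult sc mult.assoc)
  ultimately have 18: "d * d * d \<in> I" by (intro cube)
  define e where "e = c1 * c1 * c"
  have "e * e * e * e = d * d * d * c1" by (simp add: e_def d_def cs mult.assoc)
  then have "e * e * e * e \<in> I" using is_ideal_mult[OF I 18] by simp
  moreover have "star e = e" by (simp add: e_def cs star_mult sc mult.assoc)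
  ultimately have 15: "e * e * e \<in> I" by (intro cube)
  have "p = e * e * e * c" by (simp add: e_def cs mult.assoc)
  then show "p \<in> I" using is_ideal_mult[OF I 15] by simp
qed

text \<open>For z in J the square of z^* z lies in J^2, so z^* z is in I by root closedness, and z
  follows because I is hereditary.\<close>

lemma root_closed_semiprime_ideal:
  assumes I: "is_ideal I" "root_closed I"
  shows "semiprime_ideal I"
  unfolding semiprime_ideal_def
proof (intro conjI allI impI subsetI I)
  fix J z assume J: "is_ideal J" "ideal_square J \<subseteq> I" and z: "z \<in> J"
  have "star z * z \<in> J" using is_ideal_mult[OF J(1) z] by blast
  then have "(star z * z) * (star z * z) \<in> ideal_square J"
    unfolding ideal_square_def by (blast intro: group_closure.base)
  then have "star z * z \<in> I"
    using J(2) I(2) pos_star_mult_self unfolding root_closed_def by blast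
  then show "z \<in> I" by (rule root_closed_mem[OF I]) (simp_all add: pos_star_mult_self)
qed

subsection \<open>Sums of ideals closed under square roots\<close>

text \<open>The product of y n with its adjoint is y n n y^* = 0.\<close>

lemma mult_self_adjoint_cancel:
  assumes "star (n::'a::cstar_algebra) = n" "y * n * n = 0"
  shows "y * n = 0"
proof -
  have "star (star (y * n)) * star (y * n) = 0"
    using assms by (simp add: star_star star_mult flip: mult.assoc)
  then have "star (star (y * n)) = 0" by (simp del: star_zero) (metis star_zero)
  then show ?thesis by (simp add: star_star)
qed

lemma pos_sum_list: "pos (\<Sum>w\<leftarrow>ws. star w * w)"
  by (induction ws) (simp_all add: pos_add pos_star_mult_self)

lemma pos_sum_list_diff:
  assumes "w \<in> set ws"
  shows "pos ((\<Sum>w\<leftarrow>ws. star w * w) - star w * w)"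
  using assms
proof (induction ws)
  case (Cons v ws)
  show ?case
  proof (cases "w = v")
    case True
    then show ?thesis by (simp add: pos_sum_list)
  next
    case False
    then have "pos ((\<Sum>w\<leftarrow>ws. star w * w) - star w * w)" using Cons by simp
    from pos_add[OF pos_star_mult_self[of v] this] show ?thesis by (simp add: algebra_simps)
  qed
qed simp

text \<open>Here \<open>n\<^sup>3\<^sup>2 = h\<close> is the given sum and \<open>f w = w h\<^sup>-\<^sup>1\<^sup>/\<^sup>4\<close>. The difference \<open>\<Sum> f w\<^sup>* f w - h\<^sup>1\<^sup>/\<^sup>2\<close> is annihilated by
  \<open>h\<^sup>1\<^sup>/\<^sup>4\<close> from both sides; having the form \<open>Y n\<close>, it vanishes.\<close>
lemma sqrt_sum_list:
  fixes n :: "'a::cstar_algebra"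
  assumes n: "star n = n" and n2: "n2 = n * n" and n4: "n4 = n2 * n2" and n8: "n8 = n4 * n4"
    and n16: "n16 = n8 * n8" and ws: "n16 * n16 = (\<Sum>w\<leftarrow>ws. star w * w)"
  obtains f where "n16 = (\<Sum>w\<leftarrow>ws. star (f w) * f w)"
    "\<And>w. w \<in> set ws \<Longrightarrow> pos (w * star w - f w * star (f w) * (f w * star (f w)))"
proof -
  note ns = n16 n8 n4 n2
  have sn: "star n2 = n2" "star n4 = n4" "star n8 = n8" "star n16 = n16"
    by (simp_all add: ns star_mult n mult.assoc)
  have "\<exists>r. w = r * n2 * n8" if w: "w \<in> set ws" for w
  proof -
    \<comment> \<open>l = n^5, since 32 = 2 + 6 * 5. The factor l^2 = n^10 exceeds the required n^8
      = h^(1/4) by n^2.\<close>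
    define l where "l = n4 * n"
    have "n * n * (l * l * l * (l * l * l)) = n16 * n16"
      by (simp add: l_def ns mult.assoc)
    moreover have "star l = l" "n * l = l * n"
      by (simp_all add: l_def ns star_mult n mult.assoc)
    ultimately obtain r where "w = r * (l * l)"
      using factorization_of_le[of n l 1 w] n pos_sum_list_diff[OF w] ws by auto
    then have "w = r * n2 * n8" by (simp add: l_def ns mult.assoc)
    then show ?thesis ..
  qed
  then obtain g where g: "w \<in> set ws \<Longrightarrow> w = g w * n2 * n8" for w by metis
  define f where "f w = g w * n2" for w
  define S where "S = (\<Sum>w\<leftarrow>ws. star (f w) * f w)"
  have fw: "w = f w * n8" if "w \<in> set ws" for w using g[OF that] by (simp add: f_def)
  have "(\<Sum>w\<leftarrow>ws'. star w * w) = n8 * (\<Sum>w\<leftarrow>ws'. star (f w) * f w) * n8" if "set ws' \<subseteq> set ws" for ws'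
    using that
  proof (induction ws')
    case (Cons w ws')
    have "star w * w = n8 * (star (f w) * f w) * n8"
      using fw[of w] Cons(2) sn by (metis list.set_intros(1) mult.assoc star_mult subsetD)
    then show ?case using Cons by (simp add: distrib_left distrib_right)
  qed simp
  then have S8: "n8 * S * n8 = n16 * n16" using ws by (simp add: S_def)
  \<comment> \<open>The surplus n^2 in \<open>f w\<close> lets one n be split off on the right. This
    matters because the cancellation below yields y n = 0, never y = 0.\<close>
  define Y where "Y = (\<Sum>w\<leftarrow>ws. star (f w) * (g w * n)) - n8 * n4 * n2 * n"
  have "(\<Sum>w\<leftarrow>ws'. star (f w) * f w) = (\<Sum>w\<leftarrow>ws'. star (f w) * (g w * n)) * n" for ws'
    by (induction ws') (simp_all add: f_def n2 distrib_right mult.assoc)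
  then have Y: "S - n16 = Y * n"
    by (simp add: S_def Y_def left_diff_distrib ns mult.assoc)
  \<comment> \<open>Enlarging the exponent to 16 makes repeated halving end exactly at y n =
    0.\<close>
  have cancel: "y * n = 0" if "y * n * n8 = 0" for y
  proof -
    have "y * n8 * n8 = y * n * n8 * (n4 * n2 * n)" by (simp add: ns mult.assoc)
    then have "y * n8 = 0" using that mult_self_adjoint_cancel[OF sn(3)] by simp
    then have "y * n4 = 0"
      using mult_self_adjoint_cancel[OF sn(2), of y] by (simp add: n8 mult.assoc)
    then have "y * n2 = 0"
      using mult_self_adjoint_cancel[OF sn(1), of y] by (simp add: n4 mult.assoc)
    then show ?thesis
      using mult_self_adjoint_cancel[OF n, of y] by (simp add: n2 mult.assoc)
  qed
  have "n8 * (S - n16) * n8 = 0"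
    using S8 by (simp add: left_diff_distrib right_diff_distrib n16 mult.assoc)
  then have "n8 * Y * n * n8 = 0" by (simp add: Y mult.assoc)
  then have "n8 * Y * n = 0" by (rule cancel)
  then have "star (n8 * (S - n16)) = 0" by (simp add: Y mult.assoc)
  moreover have "star S = S"
    unfolding S_def using pos_sum_list[of "map f ws"] by (intro pos_selfadjoint) (simp add: comp_def)
  then have "star (n8 * (S - n16)) = (S - n16) * n8" by (simp add: star_mult star_diff sn)
  ultimately have "Y * n * n8 = 0" by (simp add: Y)
  then have "Y * n = 0" by (rule cancel)
  then have S: "n16 = S" using Y by simp
  show ?thesis
  proof (rule that[of f])
    show "n16 = (\<Sum>w\<leftarrow>ws. star (f w) * f w)" using S by (simp add: S_def)
    fix w assume w: "w \<in> set ws"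
    have "(\<Sum>w\<leftarrow>ws. star (f w) * f w) = (\<Sum>v\<leftarrow>map f ws. star v * v)" by (simp add: comp_def)
    then have "pos (S - star (f w) * f w)"
      using pos_sum_list_diff[of "f w" "map f ws"] w by (simp add: S_def)
    then have "pos (star (star (f w)) * (S - star (f w) * f w) * star (f w))" by (rule pos_conj)
    moreover have "w * star w = f w * S * star (f w)"
      using fw[OF w] by (metis S n16 sn(3) star_mult mult.assoc)
    ultimately show "pos (w * star w - f w * star (f w) * (f w * star (f w)))"
      by (simp add: star_star algebra_simps)
  qed
qed

text \<open>Heredity gives c c^* in I. Multiplying by c^* on the left and c on the right gives the
  square of c^* c, whose root is again in I and controls c.\<close>

lemma root_closed_mem_of_square_le:
  assumes I: "is_ideal I" "root_closed I" and w: "w \<in> I"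
    and c: "pos (w * star w - c * star c * (c * star c))"
  shows "c \<in> I"
proof -
  have "c * star c \<in> I"
    using c pos_star_mult_self[of "star w"]
    by (intro root_closed_mem[OF I is_ideal_mult(2)[OF I(1) w, of "star w"]])
      (simp_all add: star_star star_mult)
  then have "(star c * c) * (star c * c) \<in> I"
    using is_ideal_mult(2)[OF I(1) is_ideal_mult(1)[OF I(1)], of "c * star c" "star c" c]
    by (simp add: mult.assoc)
  then have "star c * c \<in> I" using I(2) pos_star_mult_self unfolding root_closed_def by blast
  then show ?thesis by (rule root_closed_mem[OF I]) (simp_all add: pos_star_mult_self)
qed

context
  fixes \<Lambda> :: "'i set" and I :: "'i \<Rightarrow> 'a::cstar_algebra set"
  assumes I: "\<And>l. l \<in> \<Lambda> \<Longrightarrow> is_ideal (I l)" "\<And>l. l \<in> \<Lambda> \<Longrightarrow> root_closed (I l)"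
begin

text \<open>The new summands come from the individual ideals again, so the step can be applied to
  its own output.\<close>

lemma sqrt_sum_list_mem:
  fixes n :: 'a
  assumes "star n = n" and "n2 = n * n" "n4 = n2 * n2" "n8 = n4 * n4" "n16 = n8 * n8"
    and "n16 * n16 = (\<Sum>w\<leftarrow>ws. star w * w)" and ws: "set ws \<subseteq> (\<Union>l\<in>\<Lambda>. I l)"
  obtains cs where "n16 = (\<Sum>c\<leftarrow>cs. star c * c)" "set cs \<subseteq> (\<Union>l\<in>\<Lambda>. I l)"
proof -
  obtain f where f: "n16 = (\<Sum>w\<leftarrow>ws. star (f w) * f w)"
    "\<And>w. w \<in> set ws \<Longrightarrow> pos (w * star w - f w * star (f w) * (f w * star (f w)))"
    using sqrt_sum_list[OF assms(1-6)] by blast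
  have "f w \<in> (\<Union>l\<in>\<Lambda>. I l)" if "w \<in> set ws" for w
    using ws that root_closed_mem_of_square_le[OF I _ f(2)[OF that]] by blast
  then show ?thesis using f(1) by (intro that[of "map f ws"]) (auto simp: comp_def)
qed

text \<open>An element of \<open>I l\<close> has the form \<open>w = r n\<^sup>2\<close>, and \<open>w + w\<^sup>* \<le> (n r\<^sup>*)\<^sup>* (n r\<^sup>*) + n\<^sup>2\<close>.\<close>
lemma dominated_by_squares:
  assumes "set xs \<subseteq> (\<Union>l\<in>\<Lambda>. I l)"
  shows "\<exists>ws. set ws \<subseteq> (\<Union>l\<in>\<Lambda>. I l) \<and>
    pos ((\<Sum>w\<leftarrow>ws. star w * w) - (sum_list xs + star (sum_list xs)))"
  using assms
proof (induction xs)
  case Nil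
  show ?case by (rule exI[of _ "[]"]) simp
next
  case (Cons x xs)
  then obtain ws where ws: "set ws \<subseteq> (\<Union>l\<in>\<Lambda>. I l)"
    "pos ((\<Sum>w\<leftarrow>ws. star w * w) - (sum_list xs + star (sum_list xs)))"
    by auto
  obtain l where l: "l \<in> \<Lambda>" "x \<in> I l" using Cons(2) by auto
  obtain r n where rn: "x = r * (n * n)" "star n = n" "n \<in> I l"
    using root_closed_factorization[OF I(1,2)[OF l(1)] is_ideal_mult(1)[OF I(1)[OF l(1)] l(2)], of "star x" x]
    by (auto simp: pos_star_mult_self)
  have "star (n * star r - n) * (n * star r - n) =
      star (n * star r) * (n * star r) + star n * n - (x + star x)"
    by (simp add: rn star_mult star_diff star_star algebra_simps)
  then have "pos (star (n * star r) * (n * star r) + star n * n - (x + star x))"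
    by (metis pos_star_mult_self)
  from pos_add[OF this ws(2)]
  have "pos ((\<Sum>w\<leftarrow>(n * star r) # n # ws. star w * w) - (sum_list (x # xs) + star (sum_list (x # xs))))"
    by (simp add: star_add algebra_simps)
  moreover have "set ((n * star r) # n # ws) \<subseteq> (\<Union>l\<in>\<Lambda>. I l)"
    using ws(1) l(1) rn(3) is_ideal_mult(2)[OF I(1)[OF l(1)] rn(3)] by auto
  ultimately show ?case by blast
qed

lemma root_closed_ideal_sum: "root_closed (ideal_sum \<Lambda> I)"
  unfolding root_closed_def
proof (intro allI impI)
  fix p assume p: "pos p" "p * p \<in> ideal_sum \<Lambda> I"
  have K: "is_ideal (ideal_sum \<Lambda> I)" using I(1) by (rule is_ideal_ideal_sum)
  have sp: "star p = p" by (rule pos_selfadjoint[OF p(1)])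
  obtain xs where xs: "p * p = sum_list xs" "set xs \<subseteq> (\<Union>l\<in>\<Lambda>. I l)"
    using p(2) unfolding ideal_sum_def by blast
  obtain ws where ws: "set ws \<subseteq> (\<Union>l\<in>\<Lambda>. I l)"
    "pos ((\<Sum>w\<leftarrow>ws. star w * w) - (sum_list xs + star (sum_list xs)))"
    using dominated_by_squares[OF xs(2)] by blast
  define h where "h = (\<Sum>w\<leftarrow>ws. star w * w)"
  have "pos (h - (p * p + p * p))" using ws(2) by (simp add: h_def sp star_mult flip: xs(1))
  from pos_add[OF this pos_star_mult_self[of p]]
  have hp: "pos (h - star p * p)" by (simp add: sp)
  have "pos h" by (simp add: h_def pos_sum_list)
  \<comment> \<open>Each use of \<open>sqrt_sum_list_mem\<close> needs a 32nd root of its sum. The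
    second use starts from h^(1/2), hence the 64th root n of h.\<close>
  obtain n32 where n32: "pos n32" "n32 * n32 = h" using pos_ex_sqrt[OF \<open>pos h\<close>] .
  obtain n16 where n16: "pos n16" "n16 * n16 = n32" using pos_ex_sqrt[OF n32(1)] .
  obtain n8 where n8: "pos n8" "n8 * n8 = n16" using pos_ex_sqrt[OF n16(1)] .
  obtain n4 where n4: "pos n4" "n4 * n4 = n8" using pos_ex_sqrt[OF n8(1)] .
  obtain n2 where n2: "pos n2" "n2 * n2 = n4" using pos_ex_sqrt[OF n4(1)] .
  obtain n where n: "pos n" "n * n = n2" using pos_ex_sqrt[OF n2(1)] .
  note sa = pos_selfadjoint[OF n(1)] pos_selfadjoint[OF n2(1)]
  note ns = n(2)[symmetric] n2(2)[symmetric] n4(2)[symmetric] n8(2)[symmetric]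
  have h: "n32 * n32 = (\<Sum>w\<leftarrow>ws. star w * w)" by (simp add: n32(2) h_def)
  obtain us where us: "n32 = (\<Sum>c\<leftarrow>us. star c * c)" "set us \<subseteq> (\<Union>l\<in>\<Lambda>. I l)"
    using sqrt_sum_list_mem[OF sa(2) n2(2)[symmetric] n4(2)[symmetric] n8(2)[symmetric]
        n16(2)[symmetric] h ws(1)] .
  obtain vs where vs: "n16 = (\<Sum>c\<leftarrow>vs. star c * c)" "set vs \<subseteq> (\<Union>l\<in>\<Lambda>. I l)"
    using sqrt_sum_list_mem[OF sa(1) n(2)[symmetric] n2(2)[symmetric] n4(2)[symmetric]
        n8(2)[symmetric] trans[OF n16(2) us(1)] us(2)] .
  have "set (map (\<lambda>c. star c * c) vs) \<subseteq> (\<Union>l\<in>\<Lambda>. I l)"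
    using vs(2) is_ideal_mult(1)[OF I(1)] by fastforce
  then have n16K: "n16 \<in> ideal_sum \<Lambda> I" unfolding vs(1) ideal_sum_def by blast
  \<comment> \<open>l = n^10, since 64 = 4 + 6 * 10. Then p factors through l^2 = n^20, which
    contains n^16 but not n^32; this is why h^(1/4), and so a second halving, is required.\<close>
  define l where "l = n8 * n2"
  have "n2 * n2 * (l * l * l * (l * l * l)) = h"
    by (simp add: l_def ns mult.assoc flip: n32(2) n16(2))
  moreover have "star l = l" "n2 * l = l * n2"
    by (simp_all add: l_def ns star_mult sa(1) mult.assoc)
  ultimately obtain r where "p = r * (l * l)"
    using factorization_of_le[of n2 l 1 p] sa(2) hp by auto
  also have "\<dots> = r * n4 * n16" by (simp add: l_def ns mult.assoc)
  finally show "p \<in> ideal_sum \<Lambda> I" using is_ideal_mult[OF K n16K] by simp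
qed

end

theorem theoremE:
  fixes \<Lambda> :: "'i set" and I :: "'i \<Rightarrow> 'a::cstar_algebra set"
  assumes "\<And>l. l \<in> \<Lambda> \<Longrightarrow> semiprime_ideal (I l)"
  shows "semiprime_ideal (\<Inter>l\<in>\<Lambda>. I l) \<and> semiprime_ideal (ideal_sum \<Lambda> I)"
proof
  have I: "is_ideal (I l)" if "l \<in> \<Lambda>" for l
    using assms[OF that] by (simp add: semiprime_ideal_def)
  show "semiprime_ideal (\<Inter>l\<in>\<Lambda>. I l)"
    using is_ideal_INT[of \<Lambda> I, OF I] assms unfolding semiprime_ideal_def by (simp add: le_INF_iff)
  show "semiprime_ideal (ideal_sum \<Lambda> I)"
    using root_closed_semiprime_ideal[OF is_ideal_ideal_sum[OF I]
        root_closed_ideal_sum[OF I semiprime_ideal_root_closed[OF assms]]] .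
qed

end
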